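(* Assume $H$ is a non-negative measurable function on $\mathbb R^n\times\mathbb R^n$, $S\subset\mathbb R^n$ is a measurable set star-shaped about the origin, and $\{R_j\}$ is a starlike cover of $S$. Define the starlike maximal operator $$M_{S,H}f(x)=\sup_{t>0}\frac1{t^n}\int_{tS}H(x,y)\,|f(x-y)|\,dy .$$ Let $1<p<\infty$, $1/p+1/p'=1$, and suppose the weight $w$ satisfies for some $r>1$, and for each $j$, $$\Bigl(\frac1{|R|}\int_R w\Bigr)^{1/p}\Bigl(\frac1{|R|}\int_R w^{-rp'/p}\Bigr)^{1/(rp')}\le\frac{K_j}{|R_j|}\qquad\text{for all }R\in\mathcal B(R_j),$$ where the constants $K_j$ satisfy $\sum_jK_j<\infty$. Let $1/r+1/r'=1$. If for some $\sigma>r'p'$ there is a constant $C_0$ such that $$\int_{tR_j}H(x,y)^\sigma\,dy\le C_0\,|tR_j|,\qquad x\in\mathbb R^n,$$ for all $t>0$ and all $j$, then $M_{S,H}$ is bounded on $L^p_w$ with operator norm bounded by $C\sum_jK_j$, where $C$ is independent of $\{K_j\}$.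
   Context: $L^p_w=L^p(\mathbb R^n,w(x)\,dx)$; a weight is a non-negative measurable function. A set $S$ is star-shaped about the origin if $x\in S$ implies $tx\in S$ for all $0<t<1$; $tS=\{tx:x\in S\}$. A collection $\{R_j\}$ of rectangles (arbitrarily oriented rectangular boxes) is a starlike cover of $S$ if each $R_j$ is centered at the origin, $S\subset\bigcup_jR_j$ up to a set of measure zero, and $\sum_j|R_j|\le c_n|S|$, where $c_n$ depends only on the dimension $n$. For $E\subset\mathbb R^n$, $\mathcal B(E)$ is the collection of all translates and isotropic dilates of $E$ (all sets $x+tE$, $x\in\mathbb R^n$, $t>0$). *)

theory Defs
  imports "HOL-Analysis.Analysis"
begin

text \<open>
  Measurability is Lebesgue measurability throughout.  Integrals of non-negative functions,
  averages and norms take values in \<^typ>\<open>ennreal\<close>, where \<open>0 * \<infinity> = 0\<close>.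
\<close>

text \<open>
  Real powers on \<open>[0, \<infinity>]\<close>.  For \<open>a < 0\<close> we have \<open>epow 0 a = \<infinity>\<close> (unlike \<open>0 powr a = 0\<close> on the
  reals), so that a negative power of a weight is infinite wherever the weight vanishes.
\<close>

definition epow :: "ennreal \<Rightarrow> real \<Rightarrow> ennreal" where
  "epow x a =
    (if a = 0 then 1
     else if x = 0 then (if a < 0 then \<infinity> else 0)
     else if x = \<infinity> then (if a < 0 then 0 else \<infinity>)
     else ennreal (enn2real x powr a))"

definition weight :: "(real^'n \<Rightarrow> real) \<Rightarrow> bool" where
  "weight w \<longleftrightarrow> w \<in> borel_measurable lebesgue \<and> (\<forall>x. 0 \<le> w x)"

text \<open>The (quasi-)norm of \<open>L\<^sup>p(w dx)\<close>, applied to the absolute value of a function.\<close>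

definition Lpw_norm :: "real \<Rightarrow> (real^'n \<Rightarrow> real) \<Rightarrow> (real^'n \<Rightarrow> ennreal) \<Rightarrow> ennreal" where
  "Lpw_norm p w g =
     epow (\<integral>\<^sup>+x. epow (g x) p \<partial>density lebesgue (\<lambda>x. ennreal (w x))) (1 / p)"

text \<open>
  The operator maps complex-valued functions to functions with values in \<open>[0, \<infinity>]\<close>.  Boundedness
  includes measurability of \<open>T f\<close>; finiteness of its norm follows from the inequality.
\<close>

definition bounded_on_Lpw ::
  "real \<Rightarrow> (real^'n \<Rightarrow> real) \<Rightarrow> ((real^'n \<Rightarrow> complex) \<Rightarrow> real^'n \<Rightarrow> ennreal) \<Rightarrow> real \<Rightarrow> bool" where
  "bounded_on_Lpw p w T B \<longleftrightarrow>
     (\<forall>f. f \<in> borel_measurable lebesgue \<and> Lpw_norm p w (\<lambda>x. ennreal (cmod (f x))) < \<infinity> \<longrightarrow>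
        T f \<in> borel_measurable lebesgue \<and>
        Lpw_norm p w (T f) \<le> ennreal B * Lpw_norm p w (\<lambda>x. ennreal (cmod (f x))))"

definition star_shaped :: "(real^'n) set \<Rightarrow> bool" where
  "star_shaped S \<longleftrightarrow> (\<forall>x\<in>S. \<forall>t. 0 < t \<and> t < 1 \<longrightarrow> t *\<^sub>R x \<in> S)"

text \<open>
  Arbitrarily oriented, non-degenerate closed boxes; \<open>T\<close> gives the orientation and
  \<open>a\<close> the half side lengths.
\<close>

definition rectangle_centered_at :: "real^'n \<Rightarrow> (real^'n) set \<Rightarrow> bool" where
  "rectangle_centered_at c R \<longleftrightarrow>
     (\<exists>(T :: real^'n \<Rightarrow> real^'n) (a :: real^'n). orthogonal_transformation T \<and> (\<forall>i. 0 < a $ i) \<and>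
        R = (\<lambda>x. c + T x) ` cbox (- a) a)"

text \<open>
  The collection is indexed by an arbitrary set \<open>J\<close> of naturals, so it is finite or countably
  infinite.  The parameter \<open>c\<close> is the dimensional constant bounding the total volume.
\<close>

definition starlike_cover ::
  "real \<Rightarrow> (real^'n) set \<Rightarrow> nat set \<Rightarrow> (nat \<Rightarrow> (real^'n) set) \<Rightarrow> bool" where
  "starlike_cover c S J R \<longleftrightarrow>
     (\<forall>j\<in>J. rectangle_centered_at 0 (R j)) \<and>
     S - (\<Union>j\<in>J. R j) \<in> null_sets lebesgue \<and>
     (\<Sum>\<^sub>\<infinity>j\<in>J. emeasure lebesgue (R j)) \<le> ennreal c * emeasure lebesgue S"

definition dilate :: "real \<Rightarrow> (real^'n) set \<Rightarrow> (real^'n) set" where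
  "dilate t E = (\<lambda>y. t *\<^sub>R y) ` E"

definition translates_dilates :: "(real^'n) set \<Rightarrow> (real^'n) set set" where
  "translates_dilates E = {(\<lambda>y. x + y) ` dilate t E | x t. 0 < t}"

definition average :: "(real^'n) set \<Rightarrow> (real^'n \<Rightarrow> ennreal) \<Rightarrow> ennreal" where
  "average R g = (\<integral>\<^sup>+y\<in>R. g y \<partial>lebesgue) / emeasure lebesgue R"

definition starlike_maximal ::
  "(real^'n) set \<Rightarrow> (real^'n \<Rightarrow> real^'n \<Rightarrow> real) \<Rightarrow> (real^'n \<Rightarrow> complex) \<Rightarrow> real^'n \<Rightarrow> ennreal" where
  "starlike_maximal S H f x =
     (SUP t\<in>{0<..}. ennreal (1 / t ^ CARD('n)) *
        (\<integral>\<^sup>+y\<in>dilate t S. ennreal (H x y * cmod (f (x - y))) \<partial>lebesgue))"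

end

theory Submission
  imports Defs
begin

text \<open>
  Hoelder's inequality with exponents \<open>\<sigma>, \<sigma>'\<close> bounds the contribution of one rectangle \<open>R\<close> by
  \<open>|R| C\<^sub>0\<^bsup>1/\<sigma>\<^esup> (M\<^sub>R |f|\<^bsup>\<sigma>'\<^esup>)\<^bsup>1/\<sigma>'\<^esup>\<close>, where \<open>M\<^sub>R\<close> is the centered maximal operator over translates and
  dilates of \<open>R\<close>.  With \<open>q = 1 + (p - 1)/r\<close> the hypothesis on \<open>w\<close> is an \<open>A\<^sub>q\<close> condition for these
  sets with constant \<open>(K/|R|)\<^sup>p\<close>, and \<open>\<sigma> > r' p'\<close> says exactly that \<open>p/\<sigma>' > q\<close>.  A Vitali covering
  argument gives the weak type \<open>(q, q)\<close> of \<open>M\<^sub>R\<close> with a bound linear in the \<open>A\<^sub>q\<close> constant: using the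
  \<open>A\<^sub>q\<close> condition on the enlarged rectangles avoids the loss from the doubling property of \<open>w\<close>.
  Interpolation with \<open>L\<^sup>\<infinity>\<close> then bounds \<open>M\<^sub>R\<close> on \<open>L\<^bsup>p/\<sigma>'\<^esup>(w)\<close> with norm a multiple of
  \<open>(K/|R|)\<^bsup>\<sigma>'\<^esup>\<close>, so that the factor \<open>|R|\<close> cancels, and the pieces are summed by Minkowski's inequality.
\<close>

subsection \<open>Powers and integral inequalities in the extended half-line\<close>

lemma epow_zero [simp]: "0 < a \<Longrightarrow> epow 0 a = 0"
  by (simp add: epow_def)

lemma epow_top [simp]: "0 < a \<Longrightarrow> epow top a = top"
  by (simp add: epow_def)

lemma epow_ennreal: "0 \<le> x \<Longrightarrow> 0 < a \<Longrightarrow> epow (ennreal x) a = ennreal (x powr a)"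
  by (auto simp: epow_def ennreal_eq_0_iff)

lemma epow_ennreal_pos: "0 < x \<Longrightarrow> epow (ennreal x) a = ennreal (x powr a)"
  by (auto simp: epow_def ennreal_eq_0_iff)

lemma epow_one_left [simp]: "epow 1 a = 1"
  using epow_ennreal_pos[of 1 a] by simp

text \<open>These are the regimes of \<open>epow\<close> for a nonzero exponent, so most of its laws
  reduce to those of \<open>powr\<close> on positive reals.\<close>

lemma ennreal_real_cases:
  obtains "x = top" | "x = 0" | y where "0 < y" "x = ennreal y"
  by (metis ennreal_0 ennreal_cases infinity_ennreal_def le_less)

lemma epow_eq_0_iff: "0 < a \<Longrightarrow> epow x a = 0 \<longleftrightarrow> x = 0"
  by (cases x rule: ennreal_real_cases) (auto simp: epow_ennreal_pos ennreal_eq_0_iff)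

lemma epow_mono: "0 < a \<Longrightarrow> x \<le> y \<Longrightarrow> epow x a \<le> epow y a"
  by (cases x rule: ennreal_real_cases; cases y rule: ennreal_real_cases)
     (auto simp: epow_ennreal_pos powr_mono2 top_unique)

text \<open>A positive power fixes 0 and infinity, so it respects the convention 0 * infinity = 0.
  For a negative exponent the pair 0, infinity would violate the identity.\<close>

lemma epow_mult: "0 < a \<Longrightarrow> epow (x * y) a = epow x a * epow y a"
  by (cases x rule: ennreal_real_cases; cases y rule: ennreal_real_cases)
     (auto simp: epow_ennreal_pos ennreal_mult_top ennreal_top_mult powr_mult simp flip: ennreal_mult')

lemma epow_epow: "0 < a \<Longrightarrow> 0 < b \<Longrightarrow> epow (epow x a) b = epow x (a * b)"
  by (cases x rule: ennreal_real_cases) (auto simp: epow_ennreal_pos powr_powr)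

lemma epow_one [simp]: "epow x 1 = x"
  by (cases x rule: ennreal_real_cases) (auto simp: epow_ennreal_pos)

lemma epow_add: "0 < a \<Longrightarrow> 0 < b \<Longrightarrow> epow x (a + b) = epow x a * epow x b"
  by (cases x rule: ennreal_real_cases)
     (auto simp: epow_ennreal_pos powr_add ennreal_mult_top ennreal_mult')

lemma epow_le_iff: "0 < a \<Longrightarrow> epow x a \<le> y \<longleftrightarrow> x \<le> epow y (1 / a)"
  using epow_mono[of a x "epow y (1 / a)"] epow_mono[of "1 / a" "epow x a" y]
  by (auto simp: epow_epow)

lemma measurable_epow [measurable]:
  assumes [measurable]: "f \<in> borel_measurable M"
  shows "(\<lambda>x. epow (f x) a) \<in> borel_measurable M"
proof -
  have "(\<lambda>x. if f x = 0 then c else if f x = \<infinity> then d else ennreal (enn2real (f x) powr a)) \<in> borel_measurable M" for c d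
    by (intro measurable_If) simp_all
  then show ?thesis
    unfolding epow_def by (cases "a = 0") simp_all
qed

section \<open>Inequalities of Young, Hoelder and Minkowski type\<close>

lemma Young_epow:
  fixes a b p q :: real
  assumes "1 < p" "1 < q" "1 / p + 1 / q = 1" "0 < a" "0 < b"
  shows "x * y \<le> ennreal (a * b / (p * a powr p)) * epow x p + ennreal (a * b / (q * b powr q)) * epow y q"
proof (cases x rule: ennreal_real_cases)
  case 1
  then show ?thesis
    using assms by (auto simp: ennreal_mult_top)
next
  case x: (3 x')
  show ?thesis
  proof (cases y rule: ennreal_real_cases)
    case 1
    then show ?thesis
      using assms by (auto simp: ennreal_mult_top)
  next
    case y: (3 y')
    \<comment> \<open>Young's inequality is applied to x/a and y/b and multiplied by a b; the free
      scales a and b later normalise the two factors without any division in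
      \<open>ennreal\<close>.\<close>
    have "(x' / a) * (y' / b) \<le> (x' / a) powr p / p + (y' / b) powr q / q"
      using x y assms by (intro Youngs_inequality) auto
    then have "(a * b) * ((x' / a) * (y' / b)) \<le> (a * b) * ((x' / a) powr p / p + (y' / b) powr q / q)"
      using assms by (intro mult_left_mono) auto
    then have "x' * y' \<le> a * b / (p * a powr p) * x' powr p + a * b / (q * b powr q) * y' powr q"
      using x y assms by (simp add: powr_divide field_simps)
    then show ?thesis
      using x y assms by (simp add: epow_ennreal_pos flip: ennreal_mult' ennreal_plus)
  qed simp
qed simp

text \<open>The measure is arbitrary because the inequality is used both for Lebesgue measure and
  for counting measure on the index set. Apart from degenerate values of the two power integrals, it
  is the integrated Young inequality.\<close>

lemma nn_integral_Holder:
  fixes f g :: "'a \<Rightarrow> ennreal"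
  assumes pq: "1 < p" "1 < q" "1 / p + 1 / q = 1"
    and [measurable]: "f \<in> borel_measurable M" "g \<in> borel_measurable M"
  shows "(\<integral>\<^sup>+x. f x * g x \<partial>M)
    \<le> epow (\<integral>\<^sup>+x. epow (f x) p \<partial>M) (1 / p) * epow (\<integral>\<^sup>+x. epow (g x) q \<partial>M) (1 / q)"
    (is "?L \<le> epow ?F _ * epow ?G _")
proof -
  \<comment> \<open>This includes the case where the other power integral is infinite: the right
    side is then 0 by convention, but the product f g also vanishes almost everywhere.\<close>
  have 0: ?thesis if "?F = 0 \<or> ?G = 0"
  proof -
    have "AE x in M. f x * g x = 0"
      using that pq by (auto simp: nn_integral_0_iff_AE epow_eq_0_iff)
    then have "?L = (\<integral>\<^sup>+x. 0 \<partial>M)"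
      by (intro nn_integral_cong_AE) auto
    then show ?thesis by simp
  qed
  show ?thesis
  proof (cases ?F rule: ennreal_real_cases)
    case 1
    then show ?thesis
      using 0 pq by (cases "?G = 0") (auto simp: ennreal_top_mult epow_eq_0_iff)
  next
    case 2
    then show ?thesis using 0 by simp
  next
    case F: (3 F)
    show ?thesis
    proof (cases ?G rule: ennreal_real_cases)
      case 1
      then show ?thesis
        using 0 pq by (cases "?F = 0") (auto simp: ennreal_mult_top epow_eq_0_iff)
    next
      case 2
      then show ?thesis using 0 by simp
    next
      case G: (3 G)
      \<comment> \<open>With a and b equal to the norms of f and g, the two Young terms integrate to
        a b / p and a b / q, which add up to a b.\<close>
      define a b where "a = F powr (1 / p)" and "b = G powr (1 / q)"
      have ab: "0 < a" "0 < b" "a powr p = F" "b powr q = G"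
        using F G pq by (auto simp: a_def b_def powr_powr)
      have "?L \<le> (\<integral>\<^sup>+x. ennreal (a * b / (p * F)) * epow (f x) p
                     + ennreal (a * b / (q * G)) * epow (g x) q \<partial>M)"
        using Young_epow[OF pq ab(1,2)] ab by (intro nn_integral_mono) auto
      also have "\<dots> = ennreal (a * b / (p * F)) * ennreal F + ennreal (a * b / (q * G)) * ennreal G"
        using F G by (simp add: nn_integral_add nn_integral_cmult)
      also have "\<dots> = ennreal (a * b / p + a * b / q)"
        using F G ab pq by (simp flip: ennreal_mult' ennreal_plus)
      also have "a * b / p + a * b / q = a * b"
        using pq(3) by (metis (no_types, lifting) distrib_left mult.right_neutral times_divide_eq_right)
      also have "ennreal (a * b) = epow ?F (1 / p) * epow ?G (1 / q)"
        using F G pq by (simp add: a_def b_def epow_ennreal_pos flip: ennreal_mult')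
      finally show ?thesis .
    qed
  qed
qed

text \<open>Weighting the \<open>j\<close>-th summand by \<open>b j\<close> turns the triangle inequality for countable sums into
  Hoelder's inequality for the counting measure.\<close>
lemma nn_integral_epow_sum_le:
  fixes F :: "'i \<Rightarrow> 'a \<Rightarrow> ennreal" and b :: "'i \<Rightarrow> real"
  assumes p: "1 < p" and J: "countable J"
    and [measurable]: "\<And>j. j \<in> J \<Longrightarrow> F j \<in> borel_measurable M"
    and b: "\<And>j. j \<in> J \<Longrightarrow> 0 \<le> b j"
    and F: "\<And>j. j \<in> J \<Longrightarrow> (\<integral>\<^sup>+x. epow (F j x) p \<partial>M) \<le> ennreal (b j powr p) * N"
  shows "(\<integral>\<^sup>+x. epow (\<integral>\<^sup>+j. F j x \<partial>count_space J) p \<partial>M)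
    \<le> epow (\<integral>\<^sup>+j. ennreal (b j) \<partial>count_space J) p * N"
proof -
  define q where "q = p / (p - 1)"
  have q: "1 < q" "1 / p + 1 / q = 1" "p / q = p - 1"
    using p by (auto simp: q_def field_simps)
  let ?B = "\<integral>\<^sup>+j. ennreal (b j) \<partial>count_space J"
  \<comment> \<open>Real powers of 0 are 0, so the splitting of \<open>F j x\<close> below would
    lose the summands with \<open>b j = 0\<close>. These vanish almost everywhere, and countability
    of \<open>J\<close> gives a common null set.\<close>
  have "AE x in M. \<forall>j\<in>J. b j = 0 \<longrightarrow> F j x = 0"
  proof (subst AE_ball_countable[OF J], intro ballI)
    fix j assume j: "j \<in> J"
    show "AE x in M. b j = 0 \<longrightarrow> F j x = 0"
    proof (cases "b j = 0")
      case True
      then have "(\<integral>\<^sup>+x. epow (F j x) p \<partial>M) = 0"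
        using F[OF j] by simp
      then have "AE x in M. F j x = 0"
        using j p by (subst (asm) nn_integral_0_iff_AE) (auto simp: epow_eq_0_iff)
      then show ?thesis by simp
    qed simp
  qed
  then have "AE x in M. epow (\<integral>\<^sup>+j. F j x \<partial>count_space J) p \<le>
      epow ?B (p - 1) * (\<integral>\<^sup>+j. ennreal (b j powr (1 - p)) * epow (F j x) p \<partial>count_space J)"
  proof eventually_elim
    case (elim x)
    \<comment> \<open>The q-th powers of the factors b_j^(1/q) sum to \<open>?B\<close>; the p-th
      powers of the remaining factors carry b_j^(1-p), because p/q = p - 1.\<close>
    have "(\<integral>\<^sup>+j. F j x \<partial>count_space J)
        = (\<integral>\<^sup>+j. ennreal (b j powr (1 / q)) * (ennreal (b j powr (- (1 / q))) * F j x) \<partial>count_space J)"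
    proof (intro nn_integral_cong)
      fix j assume "j \<in> space (count_space J)"
      then have "j \<in> J" by simp
      then show "F j x = ennreal (b j powr (1 / q)) * (ennreal (b j powr (- (1 / q))) * F j x)"
        using elim b[of j]
        by (cases "b j = 0") (auto simp: powr_minus simp flip: mult.assoc ennreal_mult')
    qed
    also have "\<dots> \<le> epow (\<integral>\<^sup>+j. epow (ennreal (b j powr (1 / q))) q \<partial>count_space J) (1 / q) *
        epow (\<integral>\<^sup>+j. epow (ennreal (b j powr (- (1 / q))) * F j x) p \<partial>count_space J) (1 / p)"
      using p q by (intro nn_integral_Holder) auto
    also have "(\<integral>\<^sup>+j. epow (ennreal (b j powr (1 / q))) q \<partial>count_space J) = ?B"
      using p q b by (intro nn_integral_cong) (auto simp: epow_ennreal powr_powr)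
    also have "(\<integral>\<^sup>+j. epow (ennreal (b j powr (- (1 / q))) * F j x) p \<partial>count_space J)
        = (\<integral>\<^sup>+j. ennreal (b j powr (1 - p)) * epow (F j x) p \<partial>count_space J)"
      using p q(3) by (intro nn_integral_cong) (auto simp: epow_mult epow_ennreal powr_powr)
    finally show ?case
      using p q by (subst epow_le_iff) (auto simp: epow_mult epow_epow simp flip: q(3))
  qed
  then have "(\<integral>\<^sup>+x. epow (\<integral>\<^sup>+j. F j x \<partial>count_space J) p \<partial>M)
    \<le> (\<integral>\<^sup>+x. epow ?B (p - 1) * (\<integral>\<^sup>+j. ennreal (b j powr (1 - p)) * epow (F j x) p \<partial>count_space J) \<partial>M)"
    by (rule nn_integral_mono_AE)
  also have "\<dots> = (\<integral>\<^sup>+x. (\<integral>\<^sup>+j. epow ?B (p - 1) * (ennreal (b j powr (1 - p)) * epow (F j x) p) \<partial>count_space J) \<partial>M)"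
    by (simp add: nn_integral_cmult)
  also have "\<dots> = (\<integral>\<^sup>+j. (\<integral>\<^sup>+x. epow ?B (p - 1) * (ennreal (b j powr (1 - p)) * epow (F j x) p) \<partial>M) \<partial>count_space J)"
    using J by (intro nn_integral_count_space_nn_integral) auto
  also have "\<dots> \<le> (\<integral>\<^sup>+j. epow ?B (p - 1) * (ennreal (b j) * N) \<partial>count_space J)"
  proof (intro nn_integral_mono)
    fix j assume "j \<in> space (count_space J)"
    then have j: "j \<in> J" by simp
    have "(\<integral>\<^sup>+x. epow ?B (p - 1) * (ennreal (b j powr (1 - p)) * epow (F j x) p) \<partial>M)
        = epow ?B (p - 1) * (ennreal (b j powr (1 - p)) * (\<integral>\<^sup>+x. epow (F j x) p \<partial>M))"
      using j by (simp add: nn_integral_cmult)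
    also have "\<dots> \<le> epow ?B (p - 1) * (ennreal (b j powr (1 - p)) * (ennreal (b j powr p) * N))"
      using F[OF j] by (intro mult_left_mono) auto
    also have "ennreal (b j powr (1 - p)) * (ennreal (b j powr p) * N) = ennreal (b j) * N"
      using b[OF j] by (auto simp flip: mult.assoc ennreal_mult' powr_add)
    finally show "(\<integral>\<^sup>+x. epow ?B (p - 1) * (ennreal (b j powr (1 - p)) * epow (F j x) p) \<partial>M)
      \<le> epow ?B (p - 1) * (ennreal (b j) * N)" .
  qed
  also have "\<dots> = epow ?B (p - 1) * (?B * N)"
    by (simp add: nn_integral_cmult nn_integral_multc)
  also have "\<dots> = epow ?B p * N"
    using epow_add[of "p - 1" 1 ?B] p by (simp add: mult.assoc)
  finally show ?thesis .
qed

section \<open>Interpolation through dyadic level sets\<close>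

lemma epow_le_dyadic_sum:
  fixes s :: real
  assumes "0 < s"
  shows "epow X s \<le> (\<integral>\<^sup>+(k::int). ennreal (2 powr ((real_of_int k + 1) * s)) * indicator {k::int. ennreal (2 powr k) < X} k \<partial>count_space UNIV)"
proof (cases X rule: ennreal_real_cases)
  case 1
  \<comment> \<open>For X infinite every level is active. The levels k \<ge> 0 have coefficient at
    least 1 and already make the sum infinite.\<close>
  have "\<infinity> = emeasure (count_space UNIV) {0::int..}"
    by (simp add: infinite_Ici)
  also have "\<dots> = (\<integral>\<^sup>+k. indicator {0::int..} k \<partial>count_space UNIV)"
    by simp
  also have "\<dots> \<le> (\<integral>\<^sup>+(k::int). ennreal (2 powr ((real_of_int k + 1) * s)) * indicator {k::int. ennreal (2 powr k) < X} k \<partial>count_space UNIV)"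
    using assms 1 by (intro nn_integral_mono) (auto split: split_indicator simp: ge_one_powr_ge_zero)
  finally show ?thesis by (simp add: top_unique)
next
  case (3 x)
  \<comment> \<open>The level with 2^m < x \<le> 2^(m+1). Ceiling minus one, rather than floor,
    makes the lower inequality strict, as the level sets require; this single term dominates
    x^s.\<close>
  define m where "m = \<lceil>log 2 x\<rceil> - 1"
  have "m < log 2 x" "log 2 x \<le> m + 1"
    unfolding m_def by linarith+
  then have m: "2 powr m < x" "x \<le> 2 powr (m + 1)"
    using 3 by (auto simp: less_log_iff log_le_iff)
  have "epow X s = ennreal (x powr s)"
    using 3 by (simp add: epow_ennreal_pos)
  also have "\<dots> \<le> ennreal ((2 powr (m + 1)) powr s)"
    using m 3 assms by (intro ennreal_leI powr_mono2) auto
  also have "\<dots> = ennreal (2 powr ((real_of_int m + 1) * s)) * indicator {k::int. ennreal (2 powr k) < X} m"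
    using m 3 by (simp add: powr_powr ennreal_less_iff)
  also have "\<dots> \<le> (\<integral>\<^sup>+(k::int). ennreal (2 powr ((real_of_int k + 1) * s)) * indicator {k::int. ennreal (2 powr k) < X} k \<partial>count_space UNIV)"
    by (rule nn_integral_ge_point[where A=UNIV and x=m and p="\<lambda>k. ennreal (2 powr ((real_of_int k + 1) * s)) * indicator {k::int. ennreal (2 powr real_of_int k) < X} k"]) simp
  finally show ?thesis .
qed (use assms in simp)

text \<open>A geometric progression is comparable to its largest term. The active levels satisfy 2^k
  < 2y, so that term is at most (2y)^e, and the other factor is the sum of the series with ratio
  2^(-e).\<close>

lemma dyadic_sum_le:
  fixes y e :: real
  assumes "0 < e" "0 \<le> y"
  shows "(\<integral>\<^sup>+(k::int). ennreal (2 powr (k * e)) * indicator {k::int. 2 powr k / 2 < y} k \<partial>count_space UNIV)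
    \<le> ennreal (2 powr e / (1 - 2 powr (- e)) * y powr e)"
proof (cases "y = 0")
  case True
  have "\<not> (2::real) powr k / 2 < 0" for k :: int
    by (simp add: not_less)
  then have "{k :: int. (2::real) powr k / 2 < 0} = {}" by auto
  with True show ?thesis by simp
next
  case False
  then have y: "0 < y" using assms by simp
  define m where "m = \<lceil>log 2 y\<rceil>"
  have "m < log 2 y + 1"
    unfolding m_def by linarith
  then have "m < log 2 (2 * y)"
    using y by (simp add: log_mult)
  then have m: "2 powr m < 2 * y"
    using y by (auto simp: less_log_iff)
  have "k \<le> m" if "2 powr k / 2 < y" for k :: int
  proof -
    have "2 powr k < 2 * y" using that by simp
    then have "k < log 2 (2 * y)"
      using y by (auto simp: less_log_iff)
    then have "k < log 2 y + 1"
      using y by (simp add: log_mult)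
    then show ?thesis unfolding m_def by linarith
  qed
  then have "(\<integral>\<^sup>+(k::int). ennreal (2 powr (k * e)) * indicator {k::int. 2 powr k / 2 < y} k \<partial>count_space UNIV)
    \<le> (\<integral>\<^sup>+(k::int). ennreal (2 powr (k * e)) * indicator {..m} k \<partial>count_space UNIV)"
    by (intro nn_integral_mono) (auto split: split_indicator)
  also have "\<dots> = (\<integral>\<^sup>+(k::int). ennreal (2 powr (k * e)) \<partial>count_space {..m})"
    by (subst (2) nn_integral_count_space_indicator) auto
  \<comment> \<open>Counting downwards from m turns the sum over all integers up to m into a
    geometric series over the naturals.\<close>
  also have "\<dots> = (\<integral>\<^sup>+i. ennreal (2 powr ((m - int i) * e)) \<partial>count_space (UNIV :: nat set))"
  proof -
    have "bij_betw (\<lambda>i. m - int i) UNIV {..m}"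
      by (rule bij_betw_byWitness[where f'="\<lambda>k. nat (m - k)"]) auto
    from nn_integral_bij_count_space[OF this, of "\<lambda>k. ennreal (2 powr (k * e))"] show ?thesis by simp
  qed
  also have "\<dots> = (\<Sum>i. ennreal (2 powr (m * e) * (2 powr (- e)) ^ i))"
    by (subst nn_integral_count_space_nat)
       (auto simp: algebra_simps powr_diff powr_minus powr_powr powr_realpow[symmetric] divide_simps intro!: suminf_cong)
  also have "\<dots> = ennreal (2 powr (m * e) * (1 / (1 - 2 powr (- e))))"
    using assms by (intro suminf_ennreal_eq sums_mult geometric_sums) (auto simp: powr_less_one)
  also have "\<dots> \<le> ennreal (2 powr e / (1 - 2 powr (- e)) * y powr e)"
  proof (rule ennreal_leI)
    have "2 powr (m * e) = (2 powr m) powr e" by (simp add: powr_powr)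
    also have "\<dots> \<le> (2 * y) powr e"
      using m y assms by (intro powr_mono2) auto
    also have "\<dots> = 2 powr e * y powr e" using y by (simp add: powr_mult)
    finally have "2 powr (m * e) * (1 / (1 - 2 powr (- e))) \<le> (2 powr e * y powr e) * (1 / (1 - 2 powr (- e)))"
      using assms by (intro mult_right_mono) (auto simp: powr_less_one less_imp_le)
    then show "2 powr (m * e) * (1 / (1 - 2 powr (- e))) \<le> 2 powr e / (1 - 2 powr (- e)) * y powr e"
      by (simp add: mult_ac)
  qed
  finally show ?thesis .
qed

text \<open>Marcinkiewicz interpolation between weak type (q, q) and L^infinity, where the
  truncation to g > l/2 in the hypothesis already encodes the L^infinity end point. Summing over l =
  2^k and exchanging sum and integral leaves, at each x, the sum of 2^(k(s-q)) over the k with 2^k <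
  2 g(x); it converges because q < s.\<close>

lemma nn_integral_restricted_weak_type:
  fixes G :: "'a \<Rightarrow> ennreal" and g :: "'a \<Rightarrow> real" and q s :: real
  assumes qs: "0 < q" "q < s"
    and [measurable]: "G \<in> borel_measurable M" "g \<in> borel_measurable M"
    and g: "\<And>x. 0 \<le> g x"
    and weak: "\<And>l. 0 < l \<Longrightarrow> ennreal (l powr q) * emeasure M {x \<in> space M. ennreal l < G x}
        \<le> A * (\<integral>\<^sup>+x. ennreal (g x powr q) * indicator {x. l / 2 < g x} x \<partial>M)"
  shows "(\<integral>\<^sup>+x. epow (G x) s \<partial>M)
    \<le> ennreal (2 powr s * (2 powr (s - q) / (1 - 2 powr (- (s - q))))) * A * (\<integral>\<^sup>+x. ennreal (g x powr s) \<partial>M)"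
proof -
  define e where "e = s - q"
  have e: "0 < e" using qs by (simp add: e_def)
  have "(\<integral>\<^sup>+x. epow (G x) s \<partial>M)
    \<le> (\<integral>\<^sup>+x. (\<integral>\<^sup>+(k::int). ennreal (2 powr ((real_of_int k + 1) * s)) * indicator {x \<in> space M. ennreal (2 powr k) < G x} x
         \<partial>count_space UNIV) \<partial>M)"
    using epow_le_dyadic_sum[of s] qs
    by (intro nn_integral_mono) (auto simp: indicator_def)
  also have "\<dots> = (\<integral>\<^sup>+(k::int). ennreal (2 powr ((real_of_int k + 1) * s)) * emeasure M {x \<in> space M. ennreal (2 powr k) < G x}
         \<partial>count_space UNIV)"
    by (subst nn_integral_count_space_nn_integral) (auto intro!: nn_integral_cong nn_integral_cmult_indicator)
  also have "\<dots> \<le> (\<integral>\<^sup>+(k::int). A * ennreal (2 powr s) * (\<integral>\<^sup>+x. ennreal (g x powr q) *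
      (ennreal (2 powr (k * e)) * indicator {x. 2 powr k / 2 < g x} x) \<partial>M) \<partial>count_space UNIV)"
  proof (intro nn_integral_mono)
    \<comment> \<open>The exponent is split so that (2^k)^q is absorbed by the weak-type hypothesis
      at height 2^k, while 2^(k e) remains for the geometric sum.\<close>
    fix k :: int
    have "2 powr ((real_of_int k + 1) * s) = 2 powr s * 2 powr (k * e) * ((2 powr k) powr q)"
      by (simp add: powr_powr e_def algebra_simps flip: powr_add)
    then have "ennreal (2 powr ((real_of_int k + 1) * s)) * emeasure M {x \<in> space M. ennreal (2 powr k) < G x} =
       ennreal (2 powr s * 2 powr (k * e)) * (ennreal ((2 powr k) powr q) * emeasure M {x \<in> space M. ennreal (2 powr k) < G x})"
      by (simp add: ennreal_mult' mult_ac)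
    also have "\<dots> \<le> ennreal (2 powr s * 2 powr (k * e)) *
        (A * (\<integral>\<^sup>+x. ennreal (g x powr q) * indicator {x. 2 powr k / 2 < g x} x \<partial>M))"
      by (intro mult_left_mono weak) auto
    also have "\<dots> = A * ennreal (2 powr s) * (ennreal (2 powr (k * e)) *
        (\<integral>\<^sup>+x. ennreal (g x powr q) * indicator {x. 2 powr k / 2 < g x} x \<partial>M))"
      by (simp add: ennreal_mult' mult_ac)
    also have "ennreal (2 powr (k * e)) * (\<integral>\<^sup>+x. ennreal (g x powr q) * indicator {x. 2 powr k / 2 < g x} x \<partial>M)
      = (\<integral>\<^sup>+x. ennreal (g x powr q) * (ennreal (2 powr (k * e)) * indicator {x. 2 powr k / 2 < g x} x) \<partial>M)"
      by (subst nn_integral_cmult[symmetric]) (auto intro!: nn_integral_cong simp: mult_ac)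
    finally show "ennreal (2 powr ((real_of_int k + 1) * s)) * emeasure M {x \<in> space M. ennreal (2 powr k) < G x}
      \<le> A * ennreal (2 powr s) * (\<integral>\<^sup>+x. ennreal (g x powr q) *
      (ennreal (2 powr (k * e)) * indicator {x. 2 powr k / 2 < g x} x) \<partial>M)" .
  qed
  also have "\<dots> = A * ennreal (2 powr s) * (\<integral>\<^sup>+x. (\<integral>\<^sup>+(k::int). ennreal (g x powr q) *
      (ennreal (2 powr (k * e)) * indicator {x. 2 powr k / 2 < g x} x) \<partial>count_space UNIV) \<partial>M)"
    by (subst nn_integral_cmult) (auto simp: nn_integral_count_space_nn_integral)
  also have "\<dots> = A * ennreal (2 powr s) * (\<integral>\<^sup>+x. ennreal (g x powr q) * (\<integral>\<^sup>+(k::int).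
      (ennreal (2 powr (k * e)) * indicator {k::int. 2 powr k / 2 < g x} k) \<partial>count_space UNIV) \<partial>M)"
    by (subst nn_integral_cmult) (auto simp: indicator_def)
  also have "\<dots> \<le> A * ennreal (2 powr s) * (\<integral>\<^sup>+x. ennreal (g x powr q) *
       ennreal (2 powr e / (1 - 2 powr (- e)) * g x powr e) \<partial>M)"
    using g e by (intro mult_left_mono nn_integral_mono dyadic_sum_le) auto
  also have "(\<integral>\<^sup>+x. ennreal (g x powr q) * ennreal (2 powr e / (1 - 2 powr (- e)) * g x powr e) \<partial>M)
     = (\<integral>\<^sup>+x. ennreal (2 powr e / (1 - 2 powr (- e))) * ennreal (g x powr s) \<partial>M)"
  proof (intro nn_integral_cong)
    fix x
    define c where "c = 2 powr e / (1 - 2 powr (- e))"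
    have "g x powr q * (c * g x powr e) = c * g x powr s"
      by (simp add: e_def mult.left_commute flip: powr_add)
    then have "ennreal (g x powr q) * ennreal (c * g x powr e) = ennreal c * ennreal (g x powr s)"
      by (metis ennreal_mult' ennreal_mult'' powr_ge_zero)
    then show "ennreal (g x powr q) * ennreal (2 powr e / (1 - 2 powr (- e)) * g x powr e)
      = ennreal (2 powr e / (1 - 2 powr (- e))) * ennreal (g x powr s)"
      by (simp add: c_def)
  qed
  also have "\<dots> = ennreal (2 powr e / (1 - 2 powr (- e))) * (\<integral>\<^sup>+x. ennreal (g x powr s) \<partial>M)"
    by (intro nn_integral_cmult) auto
  finally show ?thesis
    by (simp only: e_def ennreal_mult'[OF powr_ge_zero] mult_ac)
qed

subsection \<open>Lebesgue measurability on products\<close>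

text \<open>This is completeness of Lebesgue measure: the preimages of a set under f and g differ
  only inside a null set.\<close>

lemma lebesgue_measurable_cong_AE:
  fixes f g :: "'a::euclidean_space \<Rightarrow> 'b"
  assumes f: "f \<in> lebesgue \<rightarrow>\<^sub>M N" and ae: "AE x in lebesgue. f x = g x" and g: "range g \<subseteq> space N"
  shows "g \<in> lebesgue \<rightarrow>\<^sub>M N"
proof (rule measurableI)
  fix A assume A: "A \<in> sets N"
  have "f -` A \<in> sets lebesgue"
    using measurable_sets[OF f A] by simp
  moreover have "AE x in lebesgue. x \<in> f -` A \<longleftrightarrow> x \<in> g -` A"
    using ae by eventually_elim simp
  ultimately show "g -` A \<inter> space lebesgue \<in> sets lebesgue"
    using completion.in_sets_AE[where A="f -` A" and B="g -` A"] by simp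
qed (use g in auto)

text \<open>Lebesgue measure on a product space is the completion of the product measure. Tonelli's
  theorem is therefore applied to a Borel representative of G, and the exceptional null set has null
  sections for almost every x; hence sections are measurable only almost everywhere.\<close>

lemma lebesgue_product_section:
  fixes G :: "'a::euclidean_space \<times> 'b::euclidean_space \<Rightarrow> ennreal"
  assumes G: "G \<in> borel_measurable lebesgue"
  shows AE_lebesgue_measurable_section: "AE x in lebesgue. (\<lambda>y. G (x, y)) \<in> borel_measurable lebesgue"
    and lebesgue_measurable_nn_integral: "(\<lambda>x. \<integral>\<^sup>+y. G (x, y) \<partial>lebesgue) \<in> borel_measurable lebesgue"
proof -
  obtain G' where G': "G' \<in> borel_measurable lborel" and ae: "AE z in lborel. G z = G' z"
    using completion_ex_borel_measurable[OF G] by blast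
  from ae have "AE z in lborel \<Otimes>\<^sub>M lborel. G z = G' z"
    by (simp only: lborel_prod)
  then have "AE x in lborel. AE y in lborel. G (x, y) = G' (x, y)"
    by (rule lborel_pair.AE_pair)
  then have sec: "AE x in lebesgue. AE y in lebesgue. G (x, y) = G' (x, y)"
    by (simp add: AE_completion_iff)
  have G'': "G' \<in> borel_measurable (lborel \<Otimes>\<^sub>M lborel)"
    using G' by (simp add: lborel_prod)
  note [measurable] = this
  from sec show "AE x in lebesgue. (\<lambda>y. G (x, y)) \<in> borel_measurable lebesgue"
  proof eventually_elim
    case (elim x)
    have "(\<lambda>y. G' (x, y)) \<in> borel_measurable lborel"
      by measurable
    then have "(\<lambda>y. G' (x, y)) \<in> borel_measurable lebesgue"
      by (rule measurable_completion)
    then show ?case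
      by (rule lebesgue_measurable_cong_AE) (use elim in \<open>auto simp: eq_commute\<close>)
  qed
  have "(\<lambda>x. \<integral>\<^sup>+y. G' (x, y) \<partial>lborel) \<in> borel_measurable lborel"
    by measurable
  then have "(\<lambda>x. \<integral>\<^sup>+y. G' (x, y) \<partial>lborel) \<in> borel_measurable lebesgue"
    by (rule measurable_completion)
  moreover have "AE x in lebesgue. (\<integral>\<^sup>+y. G' (x, y) \<partial>lborel) = (\<integral>\<^sup>+y. G (x, y) \<partial>lebesgue)"
    using sec
  proof eventually_elim
    case (elim x)
    then show ?case
      by (subst nn_integral_completion[symmetric]) (auto intro!: nn_integral_cong_AE simp: eq_commute)
  qed
  ultimately show "(\<lambda>x. \<integral>\<^sup>+y. G (x, y) \<partial>lebesgue) \<in> borel_measurable lebesgue"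
    by (rule lebesgue_measurable_cong_AE) auto
qed

text \<open>A Borel map pulls Lebesgue sets back to Lebesgue sets once preimages of null sets are
  null. By Fubini this may be checked on the sections with x fixed.\<close>

lemma lebesgue_measurable_of_sections:
  fixes h :: "'a::euclidean_space \<times> 'b::euclidean_space \<Rightarrow> 'c::euclidean_space"
  assumes h [measurable]: "h \<in> borel_measurable borel"
    and null: "\<And>N x. N \<in> null_sets lborel \<Longrightarrow> AE y in lborel. h (x, y) \<notin> N"
  shows "h \<in> lebesgue \<rightarrow>\<^sub>M lebesgue"
proof (rule completion.measurable_completion2)
  show h': "h \<in> lebesgue \<rightarrow>\<^sub>M lborel"
    by (rule measurable_completion) simp
  show "null_sets lborel \<subseteq> null_sets (distr lebesgue lborel h)"
  proof
    fix N :: "'c set" assume N: "N \<in> null_sets lborel"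
    then have [measurable]: "N \<in> sets borel" by auto
    have "{z \<in> space lborel. h z \<notin> N} \<in> sets lborel"
      by measurable
    then have "{z \<in> space (lborel \<Otimes>\<^sub>M lborel). h z \<notin> N} \<in> sets (lborel \<Otimes>\<^sub>M lborel)"
      by (simp only: lborel_prod)
    then have "AE z in lborel \<Otimes>\<^sub>M lborel. h z \<notin> N"
      by (intro lborel_pair.AE_pair_measure) (auto simp: null[OF N])
    then have "AE z in lebesgue. h z \<notin> N"
      by (simp only: lborel_prod AE_completion_iff)
    moreover have "h -` N \<in> sets lebesgue"
      using measurable_sets[OF h', of N] by simp
    ultimately have "emeasure lebesgue (h -` N) = 0"
      by (subst (asm) AE_iff_measurable[of "h -` N"]) auto
    then show "N \<in> null_sets (distr lebesgue lborel h)"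
      using h' by (auto simp: null_sets_def emeasure_distr)
  qed
qed

lemma null_sets_reflect:
  fixes x :: "'a::euclidean_space"
  assumes "N \<in> null_sets lborel"
  shows "AE y in lborel. x - y \<notin> N"
proof -
  have eq: "{y. x - y \<in> N} = (\<lambda>y. (- 1) *\<^sub>R y + x) ` N"
    by (auto simp: image_iff intro!: bexI[of _ "x - _"])
  have [measurable]: "N \<in> sets borel"
    using assms by auto
  have "{y \<in> space borel. x - y \<in> N} \<in> sets borel"
    by measurable
  then have S: "{y. x - y \<in> N} \<in> sets lborel" by simp
  have "emeasure lebesgue {y. x - y \<in> N} = 0"
    unfolding eq emeasure_lebesgue_affine using assms by (simp add: null_sets_def)
  then have "emeasure lborel {y. x - y \<in> N} = 0"
    using S by simp
  then show ?thesis
    using S by (subst AE_iff_measurable[of "{y. x - y \<in> N}"]) auto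
qed

lemma lebesgue_measurable_snd [measurable]:
  "(snd :: 'a::euclidean_space \<times> 'b::euclidean_space \<Rightarrow> 'b) \<in> lebesgue \<rightarrow>\<^sub>M lebesgue"
proof (rule lebesgue_measurable_of_sections)
  fix N :: "'b set" and x :: 'a
  assume "N \<in> null_sets lborel"
  then show "AE y in lborel. snd (x, y) \<notin> N"
    by (simp add: AE_not_in)
qed (simp add: borel_prod[symmetric])

text \<open>It makes f(x - y) measurable on the product when f is merely Lebesgue
  measurable.\<close>

lemma lebesgue_measurable_diff [measurable]:
  "(\<lambda>(x, y). x - y :: 'a::euclidean_space) \<in> lebesgue \<rightarrow>\<^sub>M lebesgue"
  by (rule lebesgue_measurable_of_sections) (auto simp: null_sets_reflect borel_prod[symmetric])

lemma lebesgue_measurable_diff' [measurable]: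
  "(\<lambda>(x, y). y - x :: 'a::euclidean_space) \<in> lebesgue \<rightarrow>\<^sub>M lebesgue"
proof -
  have "AE y in lborel. y - x \<notin> N" if "N \<in> null_sets lborel" for x :: 'a and N
    using null_sets_translation[OF that, of x] AE_not_in by fastforce
  then show ?thesis
    by (intro lebesgue_measurable_of_sections) (auto simp: borel_prod[symmetric])
qed

lemma lebesgue_measurable_const_diff [measurable]: "(\<lambda>y. x - y :: 'a::euclidean_space) \<in> lebesgue \<rightarrow>\<^sub>M lebesgue"
  and nn_integral_lebesgue_reflect: "f \<in> borel_measurable lebesgue \<Longrightarrow>
    (\<integral>\<^sup>+y. f (x - y) \<partial>lebesgue) = (\<integral>\<^sup>+y. f y \<partial>lebesgue)"
proof -
  \<comment> \<open>The reflection is the coordinatewise affine map with all factors -1; its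
    Jacobian has modulus 1, which gives the constant density 1 below.\<close>
  have T: "(\<lambda>y. x + (\<Sum>j\<in>Basis. ((- 1) * (y \<bullet> j)) *\<^sub>R j)) = (\<lambda>y. x - y)"
    by (simp add: fun_eq_iff sum_negf euclidean_representation)
  show m: "(\<lambda>y. x - y) \<in> lebesgue \<rightarrow>\<^sub>M lebesgue"
    using lebesgue_affine_measurable[of "\<lambda>_. - 1" x] unfolding T by simp
  have "lebesgue = density (distr lebesgue lebesgue (\<lambda>y. x - y)) (\<lambda>_. 1)"
    using lebesgue_affine_euclidean[of "\<lambda>_. - 1" x] unfolding T by simp
  then have d: "lebesgue = distr lebesgue lebesgue (\<lambda>y. x - y)"
    by (simp add: density_1)
  assume f: "f \<in> borel_measurable lebesgue"
  have "(\<integral>\<^sup>+y. f y \<partial>lebesgue) = (\<integral>\<^sup>+y. f y \<partial>distr lebesgue lebesgue (\<lambda>y. x - y))"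
    using d by simp
  also have "\<dots> = (\<integral>\<^sup>+y. f (x - y) \<partial>lebesgue)"
    by (subst nn_integral_distr) (use m f in auto)
  finally show "(\<integral>\<^sup>+y. f (x - y) \<partial>lebesgue) = (\<integral>\<^sup>+y. f y \<partial>lebesgue)" by simp
qed

subsection \<open>Dilates\<close>

lemma dilate_eq_vimage:
  assumes "0 < t"
  shows "dilate t E = (*\<^sub>R) (1 / t) -` E"
  using assms by (auto simp: dilate_def image_iff intro!: bexI[of _ "(1 / t) *\<^sub>R _"])

lemma mem_dilate_iff: "0 < t \<Longrightarrow> y \<in> dilate t E \<longleftrightarrow> (1 / t) *\<^sub>R y \<in> E"
  by (simp add: dilate_eq_vimage)

lemma sets_dilate: "0 < t \<Longrightarrow> E \<in> sets lebesgue \<Longrightarrow> dilate t E \<in> sets lebesgue"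
  using measurable_sets[OF lebesgue_measurable_scaling, of E "1 / t"] by (simp add: dilate_eq_vimage)

lemma emeasure_dilate:
  fixes E :: "(real^'n) set"
  shows "0 < t \<Longrightarrow> emeasure lebesgue (dilate t E) = ennreal (t ^ CARD('n)) * emeasure lebesgue E"
  using emeasure_lebesgue_affine[of t 0 E] by (simp add: dilate_def ennreal_power)

text \<open>A point s z with z in E equals t (s/t) z, and s/t shrinks z within E. Equality s = t is
  treated apart since \<open>star_shaped\<close> concerns factors strictly below 1.\<close>

lemma dilate_mono:
  assumes E: "star_shaped E" and st: "0 < s" "s \<le> t"
  shows "dilate s E \<subseteq> dilate t E"
proof (cases "s = t")
  case False
  show ?thesis
  proof
    fix y assume "y \<in> dilate s E"
    then have "(1 / s) *\<^sub>R y \<in> E" using st by (simp add: mem_dilate_iff)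
    moreover have "0 < s / t" "s / t < 1" using st False by auto
    ultimately have "(s / t) *\<^sub>R (1 / s) *\<^sub>R y \<in> E"
      using E unfolding star_shaped_def by blast
    then show "y \<in> dilate t E" using st by (simp add: mem_dilate_iff)
  qed
qed simp

text \<open>The factor \<open>t\<^sup>-\<^sup>n\<close> is continuous, so a monotone \<open>F\<close> need not be continuous here:
  approximate \<open>t\<close> by rationals from above.\<close>
lemma SUP_scaled_mono_rational:
  fixes F :: "real \<Rightarrow> ennreal"
  assumes mono: "\<And>s t. 0 < s \<Longrightarrow> s \<le> t \<Longrightarrow> F s \<le> F t"
  shows "(SUP t\<in>{0<..}. ennreal (1 / t ^ n) * F t) = (SUP t\<in>{0<..} \<inter> \<rat>. ennreal (1 / t ^ n) * F t)"
proof (rule antisym)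
  show "(SUP t\<in>{0<..}. ennreal (1 / t ^ n) * F t) \<le> (SUP t\<in>{0<..} \<inter> \<rat>. ennreal (1 / t ^ n) * F t)"
    (is "_ \<le> ?S")
  proof (rule SUP_least)
    fix t :: real assume "t \<in> {0<..}"
    then have t: "0 < t" by simp
    have "\<exists>u. u \<in> \<rat> \<and> t < u \<and> u < t + inverse (real (Suc i))" for i
      using Rats_dense_in_real[of t "t + inverse (real (Suc i))"] by auto
    then obtain u where u: "\<And>i. u i \<in> \<rat>" "\<And>i. t < u i" "\<And>i. u i < t + inverse (real (Suc i))"
      by metis
    have lim: "(\<lambda>i. t + inverse (real (Suc i))) \<longlonglongrightarrow> t"
      using tendsto_add[OF tendsto_const LIMSEQ_inverse_real_of_nat, of t] by simp
    have "u \<longlonglongrightarrow> t"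
      by (rule real_tendsto_sandwich[OF _ _ tendsto_const lim])
         (use u in \<open>auto intro!: always_eventually less_imp_le\<close>)
    then have "(\<lambda>i. ennreal (1 / u i ^ n)) \<longlonglongrightarrow> ennreal (1 / t ^ n)"
      using t by (intro tendsto_ennrealI tendsto_intros) auto
    \<comment> \<open>\<open>F t\<close> may be infinite; the products still converge because the
      limit of the first factor is not 0.\<close>
    then have "(\<lambda>i. ennreal (1 / u i ^ n) * F t) \<longlonglongrightarrow> ennreal (1 / t ^ n) * F t"
      using t by (intro tendsto_mult_ennreal tendsto_const) (auto simp: ennreal_eq_0_iff not_le)
    moreover have "ennreal (1 / u i ^ n) * F t \<le> ?S" for i
    proof -
      have "ennreal (1 / u i ^ n) * F t \<le> ennreal (1 / u i ^ n) * F (u i)"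
        using mono[OF t less_imp_le[OF u(2)]] by (intro mult_left_mono) auto
      also have "\<dots> \<le> ?S"
        using u t by (intro SUP_upper) (auto intro: less_trans)
      finally show ?thesis .
    qed
    ultimately show "ennreal (1 / t ^ n) * F t \<le> ?S"
      by (intro LIMSEQ_le_const2) auto
  qed
qed (intro SUP_subset_mono, auto)

text \<open>Monotonicity in t reduces an uncountable supremum to the countably many rational radii.
  Both the starlike and the centered maximal operators have this form.\<close>

lemma measurable_SUP_scaled_mono:
  fixes F :: "real \<Rightarrow> 'a \<Rightarrow> ennreal"
  assumes mono: "\<And>s t x. 0 < s \<Longrightarrow> s \<le> t \<Longrightarrow> F s x \<le> F t x"
    and [measurable]: "\<And>t. 0 < t \<Longrightarrow> F t \<in> borel_measurable M"
  shows "(\<lambda>x. SUP t\<in>{0<..}. ennreal (1 / t ^ n) * F t x) \<in> borel_measurable M"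
proof -
  have "(\<lambda>x. SUP t\<in>{0<..} \<inter> \<rat>. ennreal (1 / t ^ n) * F t x) \<in> borel_measurable M"
    by (intro borel_measurable_SUP) (auto intro: countable_subset[OF _ countable_rat])
  then show ?thesis
    by (subst SUP_scaled_mono_rational) (auto intro: mono)
qed

text \<open>Star-shapedness of S makes the integral over tS nondecreasing in t, and Tonelli on the
  product gives measurability in x for fixed t.\<close>

lemma starlike_maximal_measurable:
  fixes S :: "(real^'n) set" and H :: "real^'n \<Rightarrow> real^'n \<Rightarrow> real"
  assumes H: "(\<lambda>(x, y). H x y) \<in> borel_measurable lebesgue"
    and f: "f \<in> borel_measurable lebesgue"
    and S: "S \<in> sets lebesgue" "star_shaped S"
  shows "starlike_maximal S H f \<in> borel_measurable lebesgue"
  unfolding starlike_maximal_def[abs_def]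
proof (rule measurable_SUP_scaled_mono)
  fix s t :: real and x :: "real^'n" assume "0 < s" "s \<le> t"
  then show "(\<integral>\<^sup>+y\<in>dilate s S. ennreal (H x y * cmod (f (x - y))) \<partial>lebesgue)
    \<le> (\<integral>\<^sup>+y\<in>dilate t S. ennreal (H x y * cmod (f (x - y))) \<partial>lebesgue)"
    using dilate_mono[OF S(2)] by (intro nn_integral_mono mult_left_mono) (auto simp: indicator_def)
next
  fix t :: real assume "0 < t"
  then have D: "dilate t S \<in> sets lebesgue"
    using S by (simp add: sets_dilate)
  have "(\<lambda>z. (\<lambda>(x, y). H x y) z * cmod (f ((\<lambda>(x, y). x - y) z))) \<in> borel_measurable lebesgue"
    using H measurable_compose[OF f borel_measurable_norm]
    by (intro borel_measurable_times measurable_compose[OF lebesgue_measurable_diff, of "\<lambda>x. cmod (f x)"])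
  then have "(\<lambda>z. ennreal ((\<lambda>(x, y). H x y) z * cmod (f ((\<lambda>(x, y). x - y) z))) * indicator (dilate t S) (snd z))
      \<in> borel_measurable lebesgue"
    using D by (intro borel_measurable_times_ennreal measurable_compose[OF _ measurable_ennreal]
       measurable_compose[OF lebesgue_measurable_snd] borel_measurable_indicator)
  from lebesgue_measurable_nn_integral[OF this]
  show "(\<lambda>x. \<integral>\<^sup>+y\<in>dilate t S. ennreal (H x y * cmod (f (x - y))) \<partial>lebesgue) \<in> borel_measurable lebesgue"
    by simp
qed

subsection \<open>Rectangles\<close>

text \<open>Makes explicit the centre and scale that are quantified inside
  \<open>translates_dilates\<close>; the covering argument selects both.\<close>

definition shifted_dilate :: "(real^'n) set \<Rightarrow> real^'n \<Rightarrow> real \<Rightarrow> (real^'n) set" where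
  "shifted_dilate R x t = (\<lambda>y. x + y) ` dilate t R"

lemma mem_shifted_dilate_iff: "0 < t \<Longrightarrow> z \<in> shifted_dilate R x t \<longleftrightarrow> z - x \<in> dilate t R"
  by (auto simp: shifted_dilate_def image_iff intro!: bexI[of _ "z - x"])

lemma shifted_dilate_in_translates_dilates: "0 < t \<Longrightarrow> shifted_dilate R x t \<in> translates_dilates R"
  by (auto simp: shifted_dilate_def translates_dilates_def)

lemma sets_shifted_dilate: "0 < t \<Longrightarrow> R \<in> sets lebesgue \<Longrightarrow> shifted_dilate R x t \<in> sets lebesgue"
  unfolding shifted_dilate_def by (intro lebesgue_sets_translation sets_dilate)

lemma emeasure_shifted_dilate:
  fixes R :: "(real^'n) set"
  shows "0 < t \<Longrightarrow> emeasure lebesgue (shifted_dilate R x t) = ennreal (t ^ CARD('n)) * emeasure lebesgue R"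
  using emeasure_lebesgue_affine[of 1 x "dilate t R"]
  by (simp add: shifted_dilate_def emeasure_dilate add.commute)

lemma shifted_dilate_mono:
  "star_shaped R \<Longrightarrow> 0 < s \<Longrightarrow> s \<le> t \<Longrightarrow> shifted_dilate R x s \<subseteq> shifted_dilate R x t"
  unfolding shifted_dilate_def by (intro image_mono dilate_mono)

lemma average_shifted_dilate:
  fixes R :: "(real^'n) set"
  assumes t: "0 < t" and R: "emeasure lebesgue R = ennreal m" "0 < m"
  shows "average (shifted_dilate R x t) g = ennreal (1 / (t ^ CARD('n) * m)) * (\<integral>\<^sup>+y\<in>shifted_dilate R x t. g y \<partial>lebesgue)"
  using assms
  by (simp add: average_def emeasure_shifted_dilate divide_ennreal_def inverse_ennreal inverse_eq_divide mult.commute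
      flip: ennreal_mult')

text \<open>The half side lengths become a diagonal scaling, invertible because they are positive,
  followed by the orientation T. Geometric facts about rectangles thereby reduce to the cube with
  corners -1 and 1.\<close>

lemma rectangle_linear_image:
  fixes R :: "(real^'n) set"
  assumes "rectangle_centered_at 0 R"
  obtains L :: "real^'n \<Rightarrow> real^'n" where "linear L" "bij L" "R = L ` cbox (- 1) 1"
proof -
  obtain T :: "real^'n \<Rightarrow> real^'n" and a :: "real^'n" where T: "orthogonal_transformation T"
    and a: "\<And>i. 0 < a $ i" and R: "R = T ` cbox (- a) a"
    using assms by (auto simp: rectangle_centered_at_def)
  define S :: "real^'n \<Rightarrow> real^'n" where "S y = (\<chi> i. a $ i * y $ i)" for y
  have "linear S"
    by (auto simp: S_def linear_iff vec_eq_iff algebra_simps)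
  moreover have "bij S"
    by (rule o_bij[of "\<lambda>y. \<chi> i. y $ i / a $ i"]) (use a in \<open>auto simp: S_def vec_eq_iff fun_eq_iff less_imp_neq[symmetric]\<close>)
  moreover have "S ` cbox (- 1) 1 = cbox (- a) a"
  proof (intro equalityI subsetI)
    fix y assume "y \<in> S ` cbox (- 1) 1"
    then obtain u where u: "y = S u" "\<And>i. \<bar>u $ i\<bar> \<le> 1"
      by (auto simp: mem_box_cart abs_le_iff minus_le_iff)
    have "\<bar>a $ i * u $ i\<bar> \<le> a $ i" for i
      using u(2)[of i] a[of i] by (simp add: abs_mult mult_left_le)
    then show "y \<in> cbox (- a) a"
      by (auto simp: u S_def mem_box_cart abs_le_iff minus_le_iff)
  next
    fix y assume y: "y \<in> cbox (- a) a"
    have "y = S (\<chi> i. y $ i / a $ i)"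
      using a by (auto simp: S_def vec_eq_iff less_imp_neq[symmetric])
    moreover have "(\<chi> i. y $ i / a $ i) \<in> cbox (- 1) 1"
      using y a by (auto simp: mem_box_cart pos_divide_le_eq pos_le_divide_eq)
    ultimately show "y \<in> S ` cbox (- 1) 1" by blast
  qed
  ultimately show thesis
    by (intro that[of "T \<circ> S"] linear_compose bij_comp orthogonal_transformation_linear[OF T]
        orthogonal_transformation_bij[OF T]) (simp_all only: R image_comp[symmetric])
qed

lemma rectangle_compact: "rectangle_centered_at 0 R \<Longrightarrow> compact R"
  by (erule rectangle_linear_image)
     (auto intro!: compact_continuous_image linear_continuous_on simp: linear_conv_bounded_linear)

lemma rectangle_star_shaped:
  fixes R :: "(real^'n) set"
  assumes "rectangle_centered_at 0 R"
  shows "star_shaped R"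
proof -
  obtain L :: "real^'n \<Rightarrow> real^'n" where L: "linear L" "bij L" "R = L ` cbox (- 1) 1"
    by (rule rectangle_linear_image[OF assms])
  have "t *\<^sub>R u \<in> cbox (- 1) 1" if "u \<in> cbox (- 1) 1" "0 < t" "t < 1" for t and u :: "real^'n"
  proof -
    have "\<bar>t * u $ i\<bar> \<le> 1" for i
      using that by (auto simp: abs_mult mem_box_cart abs_le_iff minus_le_iff intro!: mult_le_one)
    then show ?thesis by (auto simp: mem_box_cart abs_le_iff minus_le_iff)
  qed
  then show ?thesis
    unfolding star_shaped_def L(3) by (auto simp: linear_scale[OF L(1), symmetric])
qed

lemma rectangle_symmetric:
  fixes R :: "(real^'n) set"
  assumes "rectangle_centered_at 0 R" "y \<in> R"
  shows "- y \<in> R"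
proof -
  obtain L :: "real^'n \<Rightarrow> real^'n" where L: "linear L" "bij L" "R = L ` cbox (- 1) 1"
    by (rule rectangle_linear_image[OF assms(1)])
  obtain u where u: "y = L u" "u \<in> cbox (- 1) 1" using assms(2) L(3) by blast
  then have "- y = L (- u)" "- u \<in> cbox (- 1) 1"
    using linear_neg[OF L(1)] by (auto simp: mem_box_cart minus_le_iff le_minus_iff)
  then show ?thesis using L(3) by blast
qed

lemma rectangle_measure:
  fixes R :: "(real^'n) set"
  assumes R: "rectangle_centered_at 0 R"
  shows "R \<in> sets lebesgue" "0 < measure lebesgue R" "emeasure lebesgue R = ennreal (measure lebesgue R)"
proof -
  have lm: "R \<in> lmeasurable"
    using rectangle_compact[OF R] by (rule lmeasurable_compact)
  then show "R \<in> sets lebesgue" "emeasure lebesgue R = ennreal (measure lebesgue R)"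
    by (auto simp: emeasure_eq_measure2 fmeasurableD)
  obtain L :: "real^'n \<Rightarrow> real^'n" where L: "linear L" "bij L" "R = L ` cbox (- 1) 1"
    by (rule rectangle_linear_image[OF R])
  \<comment> \<open>The image of the open cube is a nonempty open subset of R, so R has positive
    measure.\<close>
  have "open (L ` box (- 1) 1)"
    using L by (intro open_surjective_linear_image) (auto simp: bij_is_surj)
  moreover have "0 \<in> box (- 1 :: real^'n) 1"
    by (simp add: mem_box_cart)
  ultimately have "\<not> negligible (L ` box (- 1) 1)"
    by (intro open_not_negligible) auto
  moreover have "L ` box (- 1) 1 \<subseteq> R"
    unfolding L(3) by (intro image_mono box_subset_cbox)
  ultimately have "\<not> negligible R"
    using negligible_subset by blast
  then show "0 < measure lebesgue R"
    using lm by (simp add: negligible_iff_measure zero_less_measure_iff measure_nonneg less_le)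
qed

text \<open>In the coordinates in which the rectangle is a cube, the cube lies between two Euclidean
  balls whose radii have ratio at most \<open>n\<close>, so Vitali's lemma for balls applies.\<close>
lemma Vitali_rectangles:
  fixes R E :: "(real^'n) set" and \<rho> :: "real^'n \<Rightarrow> real"
  assumes R: "rectangle_centered_at 0 R" and \<rho>: "\<And>x. x \<in> E \<Longrightarrow> 0 < \<rho> x \<and> \<rho> x \<le> B"
  obtains C where "countable C" "C \<subseteq> E"
    "\<And>x y. x \<in> C \<Longrightarrow> y \<in> C \<Longrightarrow> x \<noteq> y \<Longrightarrow> shifted_dilate R x (\<rho> x) \<inter> shifted_dilate R y (\<rho> y) = {}"
    "E \<subseteq> (\<Union>x\<in>C. shifted_dilate R x (5 * real CARD('n) * \<rho> x))"
proof -
  let ?n = "real CARD('n)"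
  obtain L :: "real^'n \<Rightarrow> real^'n" where L: "linear L" "bij L" "R = L ` cbox (- 1) 1"
    by (rule rectangle_linear_image[OF R])
  define L' where "L' = inv L"
  have L': "linear L'" "\<And>x. L' (L x) = x" "\<And>x. L (L' x) = x"
    using L by (auto simp: L'_def inj_linear_imp_inv_linear bij_is_inj bij_is_surj surj_f_inv_f inv_f_f)
  have inR: "y \<in> R \<longleftrightarrow> (\<forall>i. \<bar>L' y $ i\<bar> \<le> 1)" for y
  proof -
    have "y \<in> R \<longleftrightarrow> L' y \<in> cbox (- 1) 1"
      unfolding L(3) using L'(2,3) by (auto intro!: image_eqI[of y L "L' y"])
    then show ?thesis by (auto simp: mem_box_cart abs_le_iff minus_le_iff)
  qed
  \<comment> \<open>In the coordinates \<open>L'\<close>, the shifted dilates are sup-norm balls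
    with centre \<open>L' x\<close> and radius t.\<close>
  have inQ: "y \<in> shifted_dilate R x t \<longleftrightarrow> (\<forall>i. \<bar>(L' y - L' x) $ i\<bar> \<le> t)" if "0 < t" for x y t
  proof -
    have "L' ((1 / t) *\<^sub>R (y - x)) = (1 / t) *\<^sub>R (L' y - L' x)"
      using linear_cmul[OF L'(1)] linear_diff[OF L'(1)] by simp
    then show ?thesis
      using that by (simp add: mem_shifted_dilate_iff mem_dilate_iff inR pos_divide_le_eq)
  qed
  \<comment> \<open>A sup-norm ball of radius \<rho> lies in the Euclidean ball of radius n \<rho>,
    so disjoint balls give disjoint boxes. Conversely a Euclidean ball lies in the sup-norm ball of
    equal radius, so the fivefold balls give boxes of scale 5 n \<rho>.\<close>
  obtain C where C: "countable C" "C \<subseteq> E"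
    "pairwise (\<lambda>i j. disjnt (cball (L' i) (?n * \<rho> i)) (cball (L' j) (?n * \<rho> j))) C"
    "L' ` E \<subseteq> (\<Union>i\<in>C. cball (L' i) (5 * (?n * \<rho> i)))"
  proof (rule Vitali_covering_lemma_cballs[where S="L' ` E" and K=E and a=L' and r="\<lambda>x. ?n * \<rho> x" and B="?n * B"])
    show "L' ` E \<subseteq> (\<Union>i\<in>E. cball (L' i) (?n * \<rho> i))"
      using \<rho> by (force simp: less_imp_le)
    show "0 < ?n * \<rho> i \<and> ?n * \<rho> i \<le> ?n * B" if "i \<in> E" for i
      using \<rho>[OF that] by simp
  qed blast
  show thesis
  proof (rule that[OF C(1,2)])
    have sub: "L' z \<in> cball (L' x) (?n * \<rho> x)" if "x \<in> C" "z \<in> shifted_dilate R x (\<rho> x)" for x z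
    proof -
      have "norm (L' z - L' x) \<le> (\<Sum>i\<in>UNIV. \<bar>(L' z - L' x) $ i\<bar>)"
        by (rule norm_le_l1_cart)
      also have "\<dots> \<le> (\<Sum>i\<in>(UNIV::'n set). \<rho> x)"
        using that inQ \<rho> C(2) by (intro sum_mono) blast
      finally show ?thesis by (simp add: dist_norm norm_minus_commute)
    qed
    show "shifted_dilate R x (\<rho> x) \<inter> shifted_dilate R y (\<rho> y) = {}" if "x \<in> C" "y \<in> C" "x \<noteq> y" for x y
    proof -
      have "disjnt (cball (L' x) (?n * \<rho> x)) (cball (L' y) (?n * \<rho> y))"
        using C(3) that by (auto simp: pairwise_def)
      then show ?thesis
        using sub[OF that(1)] sub[OF that(2)] unfolding disjnt_def by blast
    qed
    show "E \<subseteq> (\<Union>x\<in>C. shifted_dilate R x (5 * ?n * \<rho> x))"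
    proof
      fix z assume "z \<in> E"
      then obtain x where x: "x \<in> C" "L' z \<in> cball (L' x) (5 * (?n * \<rho> x))"
        using C(4) by blast
      have "\<bar>(L' z - L' x) $ i\<bar> \<le> 5 * ?n * \<rho> x" for i
        using component_le_norm_cart[of "L' z - L' x" i] x(2) by (simp add: dist_norm norm_minus_commute)
      moreover have "0 < 5 * ?n * \<rho> x"
        using \<rho>[of x] x C(2) by (auto intro!: mult_pos_pos)
      ultimately show "z \<in> (\<Union>x\<in>C. shifted_dilate R x (5 * ?n * \<rho> x))"
        using x inQ by blast
    qed
  qed
qed

subsection \<open>The centered maximal operator of a rectangle on weighted spaces\<close>

definition centered_maximal :: "(real^'n) set \<Rightarrow> (real^'n \<Rightarrow> ennreal) \<Rightarrow> real^'n \<Rightarrow> ennreal" where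
  "centered_maximal R g x = (SUP t\<in>{0<..}. average (shifted_dilate R x t) g)"

text \<open>Brings the supremum into the form t^(-n) times an integral over growing sets, to which
  the reduction to rational radii applies.\<close>

lemma centered_maximal_eq:
  fixes R :: "(real^'n) set"
  assumes "emeasure lebesgue R = ennreal m" "0 < m"
  shows "centered_maximal R g x =
    (SUP t\<in>{0<..}. ennreal (1 / t ^ CARD('n)) * (ennreal (1 / m) * (\<integral>\<^sup>+y\<in>shifted_dilate R x t. g y \<partial>lebesgue)))"
  unfolding centered_maximal_def using assms
  by (intro SUP_cong) (auto simp: average_shifted_dilate simp flip: mult.assoc ennreal_mult')

lemma measurable_nn_integral_shifted_dilate:
  fixes R :: "(real^'n) set"
  assumes R: "R \<in> sets lebesgue" and g: "g \<in> borel_measurable lebesgue" and t: "0 < t"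
  shows "(\<lambda>x. \<integral>\<^sup>+y\<in>shifted_dilate R x t. g y \<partial>lebesgue) \<in> borel_measurable lebesgue"
proof -
  have D: "dilate t R \<in> sets lebesgue"
    using R t by (simp add: sets_dilate)
  \<comment> \<open>The moving domain is written as the fixed set \<open>dilate t R\<close>
    evaluated at y - x, so that the integrand is one function on the product.\<close>
  have "(\<lambda>z. g (snd z) * indicator (dilate t R) ((\<lambda>(x, y). y - x) z)) \<in> borel_measurable lebesgue"
    using D g by (intro borel_measurable_times_ennreal borel_measurable_indicator
       measurable_compose[OF lebesgue_measurable_snd, of g]
       measurable_compose[OF lebesgue_measurable_diff', of "indicator (dilate t R)"])
  from lebesgue_measurable_nn_integral[OF this] show ?thesis
    using t by (simp add: indicator_def mem_shifted_dilate_iff)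
qed

lemma measurable_centered_maximal:
  fixes R :: "(real^'n) set"
  assumes R: "rectangle_centered_at 0 R" and g: "g \<in> borel_measurable lebesgue"
  shows "centered_maximal R g \<in> borel_measurable lebesgue"
proof -
  note m = rectangle_measure[OF R]
  show ?thesis
    unfolding centered_maximal_eq[OF m(3,2), abs_def]
  proof (rule measurable_SUP_scaled_mono)
    fix s t :: real and x :: "real^'n" assume "0 < s" "s \<le> t"
    then show "ennreal (1 / measure lebesgue R) * (\<integral>\<^sup>+y\<in>shifted_dilate R x s. g y \<partial>lebesgue)
      \<le> ennreal (1 / measure lebesgue R) * (\<integral>\<^sup>+y\<in>shifted_dilate R x t. g y \<partial>lebesgue)"
      using shifted_dilate_mono[OF rectangle_star_shaped[OF R]]
      by (intro mult_left_mono nn_integral_mono) (auto simp: indicator_def)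
  qed (intro borel_measurable_times_ennreal measurable_nn_integral_shifted_dilate m g, auto)
qed

text \<open>Hoelder's inequality for g = (g w^(1/q)) w^(-1/q) on Q: the conjugate exponent q/(q-1)
  turns the second factor into w^(-1/(q-1)). Enlarging only this dual integral to Q' lets the A_q
  condition on Q' control w(Q') directly, with a single factor D.\<close>

lemma nn_integral_epow_le_weighted:
  fixes w :: "real^'n \<Rightarrow> real" and g :: "real^'n \<Rightarrow> ennreal"
  assumes q: "1 < q" and w: "weight w" and g [measurable]: "g \<in> borel_measurable lebesgue"
    and Q [measurable]: "Q \<in> sets lebesgue" "Q' \<in> sets lebesgue" and sub: "Q \<subseteq> Q'"
    and v: "emeasure lebesgue Q' = ennreal v" "0 < v"
    and Aq: "average Q' (\<lambda>y. ennreal (w y)) * epow (average Q' (\<lambda>y. epow (ennreal (w y)) (- (1 / (q - 1))))) (q - 1) \<le> ennreal D"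
  shows "epow (\<integral>\<^sup>+y\<in>Q. g y \<partial>lebesgue) q * (\<integral>\<^sup>+y\<in>Q'. ennreal (w y) \<partial>lebesgue)
    \<le> ennreal D * ennreal (v powr q) * (\<integral>\<^sup>+y\<in>Q. epow (g y) q * ennreal (w y) \<partial>lebesgue)"
proof -
  have w0: "\<And>x. 0 \<le> w x" and [measurable]: "w \<in> borel_measurable lebesgue"
    using w by (auto simp: weight_def)
  define W where "W = (\<integral>\<^sup>+y\<in>Q'. ennreal (w y) \<partial>lebesgue)"
  define V where "V = (\<integral>\<^sup>+y\<in>Q'. epow (ennreal (w y)) (- (1 / (q - 1))) \<partial>lebesgue)"
  define I where "I = (\<integral>\<^sup>+y\<in>Q. epow (g y) q * ennreal (w y) \<partial>lebesgue)"
  have Aq': "(W / ennreal v) * epow (V / ennreal v) (q - 1) \<le> ennreal D"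
    using Aq v by (simp add: average_def W_def V_def)
  have cancel: "a = ennreal v * (a / ennreal v)" for a
    using v by (simp add: ennreal_times_divide mult_divide_eq_ennreal mult.commute)
  show ?thesis
  proof (cases "W = 0")
    case True
    then show ?thesis by (simp add: W_def[symmetric])
  next
    case False
    \<comment> \<open>A nonzero W and a finite D force V to be finite. Since \<open>epow 0 a\<close>
      is infinite for negative a, w is then positive almost everywhere on Q', and so w^(1/q)
      w^(-1/q) = 1 there.\<close>
    then have "W / ennreal v \<noteq> 0"
      using v by (simp add: ennreal_divide_eq_0_iff)
    moreover have "V / ennreal v = top" if "V = top"
      using v that by (simp add: ennreal_top_divide)
    ultimately have "V \<noteq> top"
      using Aq' q by (auto simp: ennreal_mult_top top_unique)
    then have "AE y in lebesgue. epow (ennreal (w y)) (- (1 / (q - 1))) * indicator Q' y \<noteq> \<infinity>"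
      unfolding V_def by (intro nn_integral_noteq_infinite) auto
    then have pos: "AE y in lebesgue. y \<in> Q \<longrightarrow> 0 < w y"
    proof eventually_elim
      case (elim y)
      then show ?case
        using sub w0[of y] q by (auto simp: epow_def less_le split: if_splits)
    qed
    define f where "f y = g y * ennreal (w y powr (1 / q)) * indicator Q y" for y
    define h where "h y = ennreal (w y powr (- (1 / q))) * indicator Q y" for y
    have [measurable]: "f \<in> borel_measurable lebesgue" "h \<in> borel_measurable lebesgue"
      unfolding f_def[abs_def] h_def[abs_def] by measurable
    have "(\<integral>\<^sup>+y\<in>Q. g y \<partial>lebesgue) = (\<integral>\<^sup>+y. f y * h y \<partial>lebesgue)"
    proof (rule nn_integral_cong_AE)
      show "AE y in lebesgue. g y * indicator Q y = f y * h y"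
        using pos
      proof eventually_elim
        case (elim y)
        have "ennreal (w y powr (1 / q)) * ennreal (w y powr (- (1 / q))) = 1" if "y \<in> Q"
          using elim that by (simp flip: ennreal_mult' powr_add)
        then show ?case
          by (auto simp: f_def h_def indicator_def mult.assoc)
      qed
    qed
    also have "\<dots> \<le> epow (\<integral>\<^sup>+y. epow (f y) q \<partial>lebesgue) (1 / q)
        * epow (\<integral>\<^sup>+y. epow (h y) (q / (q - 1)) \<partial>lebesgue) (1 / (q / (q - 1)))"
      using q by (intro nn_integral_Holder) (auto simp: field_simps)
    also have "(\<integral>\<^sup>+y. epow (f y) q \<partial>lebesgue) = I"
      unfolding I_def
      using q w0 by (intro nn_integral_cong) (auto simp: f_def indicator_def epow_mult epow_ennreal powr_powr)
    also have "epow (\<integral>\<^sup>+y. epow (h y) (q / (q - 1)) \<partial>lebesgue) (1 / (q / (q - 1))) \<le> epow V (1 / (q / (q - 1)))"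
      unfolding V_def
    proof (intro epow_mono nn_integral_mono)
      fix y
      \<comment> \<open>Where w vanishes the two conventions differ: the real power makes the left
        side 0, while the right side is infinite.\<close>
      have "epow (ennreal (w y powr (- (1 / q)))) (q / (q - 1)) \<le> epow (ennreal (w y)) (- (1 / (q - 1)))"
        using w0[of y] q by (cases "w y = 0") (auto simp: epow_ennreal powr_powr epow_ennreal_pos)
      then show "epow (h y) (q / (q - 1)) \<le> epow (ennreal (w y)) (- (1 / (q - 1))) * indicator Q' y"
        using sub q by (auto simp: h_def indicator_def)
    qed (use q in simp)
    finally have "(\<integral>\<^sup>+y\<in>Q. g y \<partial>lebesgue) \<le> epow I (1 / q) * epow V (1 / (q / (q - 1)))"
      by (simp add: mult_left_mono)
    then have "epow (\<integral>\<^sup>+y\<in>Q. g y \<partial>lebesgue) q \<le> epow (epow I (1 / q) * epow V (1 / (q / (q - 1)))) q"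
      using q by (intro epow_mono) auto
    also have "\<dots> = I * epow V (q - 1)"
      using q by (simp add: epow_mult epow_epow)
    finally have "epow (\<integral>\<^sup>+y\<in>Q. g y \<partial>lebesgue) q * W \<le> I * epow V (q - 1) * W"
      by (rule mult_right_mono) simp
    \<comment> \<open>Multiplying and dividing by v exposes the averages of the A_q condition; the
      volumes left over combine to v^(q-1) v = v^q.\<close>
    also have "\<dots> = I * (epow (ennreal v * (V / ennreal v)) (q - 1) * (ennreal v * (W / ennreal v)))"
      by (simp only: cancel[symmetric] mult.assoc)
    also have "\<dots> = I * ((epow (ennreal v) (q - 1) * ennreal v) * ((W / ennreal v) * epow (V / ennreal v) (q - 1)))"
      using q by (simp add: epow_mult mult_ac)
    also have "epow (ennreal v) (q - 1) * ennreal v = ennreal (v powr q)"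
      using epow_add[of "q - 1" 1 "ennreal v"] q v by (simp add: epow_ennreal_pos)
    also have "I * (ennreal (v powr q) * ((W / ennreal v) * epow (V / ennreal v) (q - 1)))
        \<le> I * (ennreal (v powr q) * ennreal D)"
      using Aq' by (intro mult_left_mono) auto
    finally show ?thesis
      by (simp add: W_def I_def mult_ac)
  qed
qed

text \<open>If g has average above l, its values up to l/2 supply at most half of l times the
  volume, so the truncation h carries the other half. The previous estimate for h, with the k-fold
  box as Q', gives the claim.\<close>

lemma centered_maximal_box_estimate:
  fixes R :: "(real^'n) set" and w g :: "real^'n \<Rightarrow> real" and q D k l t :: real
  assumes R: "rectangle_centered_at 0 R" and q: "1 < q" and w: "weight w"
    and g: "g \<in> borel_measurable lebesgue" "\<And>x. 0 \<le> g x" and D: "0 \<le> D" and k: "1 \<le> k"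
    and Aq: "\<And>Q. Q \<in> translates_dilates R \<Longrightarrow>
      average Q (\<lambda>y. ennreal (w y)) * epow (average Q (\<lambda>y. epow (ennreal (w y)) (- (1 / (q - 1))))) (q - 1) \<le> ennreal D"
    and t: "0 < t" and l: "0 < l" "ennreal l < average (shifted_dilate R x t) (\<lambda>y. ennreal (g y))"
  shows "ennreal (l powr q) * (\<integral>\<^sup>+y\<in>shifted_dilate R x (k * t). ennreal (w y) \<partial>lebesgue)
    \<le> ennreal (2 powr q * (k ^ CARD('n)) powr q * D) *
       (\<integral>\<^sup>+y\<in>shifted_dilate R x t. ennreal (g y powr q) * indicator {y. l / 2 < g y} y * ennreal (w y) \<partial>lebesgue)"
proof -
  note m = rectangle_measure[OF R]
  have [measurable]: "g \<in> borel_measurable lebesgue" by (fact g)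
  define v where "v = t ^ CARD('n) * measure lebesgue R"
  have v: "0 < v" using t m by (simp add: v_def)
  let ?Q = "shifted_dilate R x t" and ?Q' = "shifted_dilate R x (k * t)"
  have [measurable]: "?Q \<in> sets lebesgue" "?Q' \<in> sets lebesgue"
    using t k m by (auto intro!: sets_shifted_dilate)
  have eQ: "emeasure lebesgue ?Q = ennreal v"
    unfolding emeasure_shifted_dilate[OF t] m(3) v_def using t by (simp add: ennreal_mult')
  have eQ': "emeasure lebesgue ?Q' = ennreal (k ^ CARD('n) * v)"
  proof -
    have "0 < k * t" using t k by simp
    then show ?thesis
      unfolding emeasure_shifted_dilate[OF \<open>0 < k * t\<close>] m(3) v_def
      using t k by (simp add: power_mult_distrib ennreal_mult' mult.assoc)
  qed
  define h where "h y = ennreal (g y) * indicator {y. l / 2 < g y} y" for y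
  have [measurable]: "h \<in> borel_measurable lebesgue"
    unfolding h_def[abs_def] by measurable
  define I where "I = (\<integral>\<^sup>+y\<in>?Q. ennreal (g y) \<partial>lebesgue)"
  define h' where "h' = (\<integral>\<^sup>+y\<in>?Q. h y \<partial>lebesgue)"
  have "ennreal (l * v) < I"
  proof (rule ccontr)
    assume "\<not> ennreal (l * v) < I"
    then have "ennreal (1 / v) * I \<le> ennreal (1 / v) * ennreal (l * v)"
      by (intro mult_left_mono) auto
    also have "\<dots> = ennreal l"
      using v by (simp flip: ennreal_mult')
    finally show False
      using l t m by (simp add: average_shifted_dilate[OF t m(3,2)] I_def v_def)
  qed
  also have "I \<le> (\<integral>\<^sup>+y. h y * indicator ?Q y + ennreal (l / 2) * indicator ?Q y \<partial>lebesgue)"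
    unfolding I_def by (intro nn_integral_mono) (auto simp: h_def indicator_def intro!: ennreal_leI)
  also have "\<dots> = h' + ennreal (l / 2) * ennreal v"
    by (simp add: nn_integral_add h'_def nn_integral_cmult_indicator eQ)
  finally have less: "ennreal (l * v) < h' + ennreal (l / 2 * v)"
    using l by (simp flip: ennreal_mult')
  \<comment> \<open>Subtracting the low part requires a finite \<open>h'\<close>; for infinite
    \<open>h'\<close> the bound is immediate.\<close>
  have half: "ennreal (l * v / 2) \<le> h'"
  proof (cases h')
    case (real z)
    then show ?thesis
      using less l v by (simp add: ennreal_less_iff flip: ennreal_plus)
  qed simp
  have "ennreal ((l * v / 2) powr q) * (\<integral>\<^sup>+y\<in>?Q'. ennreal (w y) \<partial>lebesgue)
      \<le> epow h' q * (\<integral>\<^sup>+y\<in>?Q'. ennreal (w y) \<partial>lebesgue)"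
    using epow_mono[OF _ half, of q] q l v by (intro mult_right_mono) (auto simp: epow_ennreal_pos)
  also have "\<dots> \<le> ennreal D * ennreal ((k ^ CARD('n) * v) powr q) * (\<integral>\<^sup>+y\<in>?Q. epow (h y) q * ennreal (w y) \<partial>lebesgue)"
    unfolding h'_def
  proof (rule nn_integral_epow_le_weighted[OF q w _ _ _ _ eQ'])
    show "?Q \<subseteq> ?Q'"
      using t k by (intro shifted_dilate_mono rectangle_star_shaped R) auto
    show "average ?Q' (\<lambda>y. ennreal (w y)) * epow (average ?Q' (\<lambda>y. epow (ennreal (w y)) (- (1 / (q - 1))))) (q - 1) \<le> ennreal D"
      using t k by (intro Aq shifted_dilate_in_translates_dilates) auto
    show "0 < k ^ CARD('n) * v" using k v by simp
  qed measurable
  also have "(\<integral>\<^sup>+y\<in>?Q. epow (h y) q * ennreal (w y) \<partial>lebesgue)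
     = (\<integral>\<^sup>+y\<in>?Q. ennreal (g y powr q) * indicator {y. l / 2 < g y} y * ennreal (w y) \<partial>lebesgue)" (is "_ = ?J")
    using q g by (intro nn_integral_cong) (auto simp: h_def indicator_def epow_ennreal)
  \<comment> \<open>The multiplier turns (l v / 2)^q into l^q; on the right the ratio of the two
    volumes leaves (k^n)^q.\<close>
  finally have "ennreal (2 powr q / v powr q) * (ennreal ((l * v / 2) powr q) * (\<integral>\<^sup>+y\<in>?Q'. ennreal (w y) \<partial>lebesgue))
     \<le> ennreal (2 powr q / v powr q) * (ennreal D * ennreal ((k ^ CARD('n) * v) powr q) * ?J)"
    by (rule mult_left_mono) simp
  moreover have "ennreal (2 powr q / v powr q) * (ennreal ((l * v / 2) powr q) * z) = ennreal (l powr q) * z" for z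
  proof -
    have "2 powr q / v powr q * (l * v / 2) powr q = l powr q"
      using l v by (simp add: powr_mult powr_divide)
    then show ?thesis
      by (metis ennreal_mult'' mult.assoc powr_ge_zero)
  qed
  moreover have "ennreal (2 powr q / v powr q) * (ennreal D * ennreal ((k ^ CARD('n) * v) powr q) * z)
    = ennreal (2 powr q * (k ^ CARD('n)) powr q * D) * z" for z
  proof -
    have "2 powr q / v powr q * (D * (k ^ CARD('n) * v) powr q) = 2 powr q * (k ^ CARD('n)) powr q * D"
      using k v by (simp add: powr_mult)
    then show ?thesis
      by (metis D ennreal_mult'' mult.assoc mult_nonneg_nonneg powr_ge_zero)
  qed
  ultimately show ?thesis by simp
qed

lemma nn_integral_count_space_disjoint_le_1:
  assumes "\<And>i j. i \<in> C \<Longrightarrow> j \<in> C \<Longrightarrow> i \<noteq> j \<Longrightarrow> Q i \<inter> Q j = {}"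
  shows "(\<integral>\<^sup>+i. indicator (Q i) y \<partial>count_space C) \<le> (1 :: ennreal)"
proof (cases "\<exists>i\<in>C. y \<in> Q i")
  case True
  then obtain i where i: "i \<in> C" "y \<in> Q i" by blast
  have "indicator (Q j) y = (indicator {i} j :: ennreal)" if "j \<in> C" for j
    using assms[of i j] i that by (auto simp: indicator_def)
  then have "(\<integral>\<^sup>+j. indicator (Q j) y \<partial>count_space C) = (\<integral>\<^sup>+j. indicator {i} j \<partial>count_space C)"
    by (intro nn_integral_cong) auto
  also have "\<dots> = 1"
    using i by simp
  finally show ?thesis by simp
next
  case False
  then have "(\<integral>\<^sup>+j. indicator (Q j) y \<partial>count_space C) = (\<integral>\<^sup>+j. (0 :: ennreal) \<partial>count_space C)"
    by (intro nn_integral_cong) auto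
  then show ?thesis by simp
qed

text \<open>Each point of the level set chooses a box with average above l, and Vitali selects
  disjoint ones whose 5n-fold enlargements cover. The box estimates are then summed: the enlarged
  boxes bound the level set, and the disjoint ones bound the integral.\<close>

lemma centered_maximal_weak_type:
  fixes R :: "(real^'n) set" and w g :: "real^'n \<Rightarrow> real" and q D l :: real
  assumes R: "rectangle_centered_at 0 R" and q: "1 < q" and w: "weight w"
    and g: "g \<in> borel_measurable lebesgue" "\<And>x. 0 \<le> g x" and D: "0 \<le> D"
    and Aq: "\<And>Q. Q \<in> translates_dilates R \<Longrightarrow>
      average Q (\<lambda>y. ennreal (w y)) * epow (average Q (\<lambda>y. epow (ennreal (w y)) (- (1 / (q - 1))))) (q - 1) \<le> ennreal D"
    and l: "0 < l"
  shows "ennreal (l powr q) * emeasure (density lebesgue (\<lambda>x. ennreal (w x)))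
      {x. ennreal l < centered_maximal R (\<lambda>y. ennreal (g y)) x}
    \<le> ennreal (2 powr q * ((5 * real CARD('n)) ^ CARD('n)) powr q * D) *
       (\<integral>\<^sup>+x. ennreal (g x powr q) * indicator {x. l / 2 < g x} x \<partial>density lebesgue (\<lambda>x. ennreal (w x)))"
    (is "_ * emeasure ?\<mu> _ \<le> ?A * ?I")
proof -
  note m = rectangle_measure[OF R]
  have [measurable]: "g \<in> borel_measurable lebesgue" "w \<in> borel_measurable lebesgue"
    using g w by (auto simp: weight_def)
  let ?g = "\<lambda>y. ennreal (g y)"
  let ?k = "5 * real CARD('n)"
  have k: "1 \<le> ?k"
  proof -
    have "1 \<le> real CARD('n)"
      using zero_less_card_finite[where 'a='n] by linarith
    then show ?thesis by linarith
  qed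
  \<comment> \<open>Rational radii make the level set a countable union of measurable sets, and the
    bound i supplies the bounded radii that Vitali's lemma demands.\<close>
  define Ts where "Ts i = {0<..real i} \<inter> \<rat>" for i :: nat
  define E where "E i = (\<Union>t\<in>Ts i. {x. ennreal l < average (shifted_dilate R x t) ?g})" for i
  have E_sets: "E i \<in> sets lebesgue" for i
    unfolding E_def
  proof (rule sets.countable_UN'')
    show "countable (Ts i)"
      unfolding Ts_def by (rule countable_subset[OF _ countable_rat]) auto
    fix t assume "t \<in> Ts i"
    then have t: "0 < t" by (simp add: Ts_def)
    have [measurable]: "(\<lambda>x. average (shifted_dilate R x t) ?g) \<in> borel_measurable lebesgue"
      unfolding average_shifted_dilate[OF t m(3,2)]
      by (intro borel_measurable_times_ennreal measurable_nn_integral_shifted_dilate m t) auto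
    have "{x \<in> space lebesgue. ennreal l < average (shifted_dilate R x t) ?g} \<in> sets lebesgue"
      by measurable
    then show "{x. ennreal l < average (shifted_dilate R x t) ?g} \<in> sets lebesgue" by simp
  qed
  have E_UN: "{x. ennreal l < centered_maximal R ?g x} = (\<Union>i. E i)"
  proof -
    have "centered_maximal R ?g x = (SUP t\<in>{0<..} \<inter> \<rat>. average (shifted_dilate R x t) ?g)" for x
    proof -
      have "centered_maximal R ?g x =
          (SUP t\<in>{0<..} \<inter> \<rat>. ennreal (1 / t ^ CARD('n)) * (ennreal (1 / measure lebesgue R) *
             (\<integral>\<^sup>+y\<in>shifted_dilate R x t. ?g y \<partial>lebesgue)))"
        unfolding centered_maximal_eq[OF m(3,2)]
      proof (rule SUP_scaled_mono_rational)
        fix s t :: real assume "0 < s" "s \<le> t"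
        then show "ennreal (1 / measure lebesgue R) * (\<integral>\<^sup>+y\<in>shifted_dilate R x s. ?g y \<partial>lebesgue)
          \<le> ennreal (1 / measure lebesgue R) * (\<integral>\<^sup>+y\<in>shifted_dilate R x t. ?g y \<partial>lebesgue)"
          using shifted_dilate_mono[OF rectangle_star_shaped[OF R]]
          by (intro mult_left_mono nn_integral_mono) (auto simp: indicator_def)
      qed
      also have "\<dots> = (SUP t\<in>{0<..} \<inter> \<rat>. average (shifted_dilate R x t) ?g)"
        using m by (intro SUP_cong) (auto simp: average_shifted_dilate simp flip: mult.assoc ennreal_mult')
      finally show ?thesis .
    qed
    then have "{x. ennreal l < centered_maximal R ?g x}
        = (\<Union>t\<in>{0<..} \<inter> \<rat>. {x. ennreal l < average (shifted_dilate R x t) ?g})"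
      by (auto simp: less_SUP_iff)
    also have "{0<..} \<inter> \<rat> = (\<Union>i. Ts i)"
      using real_arch_simple by (auto simp: Ts_def)
    finally show ?thesis by (simp add: E_def)
  qed
  have "incseq E"
    unfolding incseq_def E_def Ts_def by (force intro: order_trans of_nat_mono)
  have bound: "ennreal (l powr q) * emeasure ?\<mu> (E i) \<le> ?A * ?I" for i
  proof -
    have "\<forall>x\<in>E i. \<exists>t. 0 < t \<and> t \<le> real i \<and> ennreal l < average (shifted_dilate R x t) ?g"
      by (auto simp: E_def Ts_def)
    then obtain \<rho> where \<rho>: "\<And>x. x \<in> E i \<Longrightarrow> 0 < \<rho> x \<and> \<rho> x \<le> real i \<and>
        ennreal l < average (shifted_dilate R x (\<rho> x)) ?g"
      by metis
    obtain C where C: "countable C" "C \<subseteq> E i"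
      "\<And>x y. x \<in> C \<Longrightarrow> y \<in> C \<Longrightarrow> x \<noteq> y \<Longrightarrow> shifted_dilate R x (\<rho> x) \<inter> shifted_dilate R y (\<rho> y) = {}"
      "E i \<subseteq> (\<Union>x\<in>C. shifted_dilate R x (?k * \<rho> x))"
      using Vitali_rectangles[OF R, of "E i" \<rho> "real i"] \<rho> by blast
    let ?Q = "\<lambda>c. shifted_dilate R c (\<rho> c)" and ?Q' = "\<lambda>c. shifted_dilate R c (?k * \<rho> c)"
    have pos: "0 < \<rho> c" if "c \<in> C" for c
      using \<rho> C(2) that by blast
    have [measurable]: "?Q c \<in> sets lebesgue" "?Q' c \<in> sets lebesgue" if "c \<in> C" for c
      using pos[OF that] m(1) by (auto intro!: sets_shifted_dilate mult_pos_pos)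
    have "emeasure ?\<mu> (E i) = (\<integral>\<^sup>+x. ennreal (w x) * indicator (E i) x \<partial>lebesgue)"
      using E_sets by (intro emeasure_density) auto
    also have "\<dots> \<le> (\<integral>\<^sup>+x. (\<integral>\<^sup>+c. ennreal (w x) * indicator (?Q' c) x \<partial>count_space C) \<partial>lebesgue)"
    proof (rule nn_integral_mono)
      fix x
      show "ennreal (w x) * indicator (E i) x \<le> (\<integral>\<^sup>+c. ennreal (w x) * indicator (?Q' c) x \<partial>count_space C)"
      proof (cases "x \<in> E i")
        case True
        then obtain c where c: "c \<in> C" "x \<in> ?Q' c" using C(4) by blast
        then show ?thesis
          using nn_integral_ge_point[of c C "\<lambda>c. ennreal (w x) * indicator (?Q' c) x"] True by simp
      qed simp
    qed
    also have "\<dots> = (\<integral>\<^sup>+c. (\<integral>\<^sup>+x. ennreal (w x) * indicator (?Q' c) x \<partial>lebesgue) \<partial>count_space C)"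
      using C(1) by (intro nn_integral_count_space_nn_integral) auto
    finally have "ennreal (l powr q) * emeasure ?\<mu> (E i)
        \<le> ennreal (l powr q) * (\<integral>\<^sup>+c. (\<integral>\<^sup>+x. ennreal (w x) * indicator (?Q' c) x \<partial>lebesgue) \<partial>count_space C)"
      by (rule mult_left_mono) simp
    also have "\<dots> = (\<integral>\<^sup>+c. ennreal (l powr q) * (\<integral>\<^sup>+x. ennreal (w x) * indicator (?Q' c) x \<partial>lebesgue) \<partial>count_space C)"
      by (simp add: nn_integral_cmult)
    also have "\<dots> \<le> (\<integral>\<^sup>+c. ?A * (\<integral>\<^sup>+x\<in>?Q c. ennreal (g x powr q) * indicator {y. l / 2 < g y} x * ennreal (w x) \<partial>lebesgue) \<partial>count_space C)"
    proof (rule nn_integral_mono)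
      fix c assume "c \<in> space (count_space C)"
      then have c: "c \<in> C" by simp
      then have "ennreal l < average (?Q c) ?g" using \<rho> C(2) by blast
      from centered_maximal_box_estimate[OF R q w g D k Aq pos[OF c] l this]
      show "ennreal (l powr q) * (\<integral>\<^sup>+x. ennreal (w x) * indicator (?Q' c) x \<partial>lebesgue)
        \<le> ?A * (\<integral>\<^sup>+x\<in>?Q c. ennreal (g x powr q) * indicator {y. l / 2 < g y} x * ennreal (w x) \<partial>lebesgue)" .
    qed
    also have "\<dots> = ?A * (\<integral>\<^sup>+x. (\<integral>\<^sup>+c. ennreal (g x powr q) * indicator {y. l / 2 < g y} x * ennreal (w x) * indicator (?Q c) x
        \<partial>count_space C) \<partial>lebesgue)"
      using C(1) by (subst nn_integral_count_space_nn_integral) (auto simp: nn_integral_cmult)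
    \<comment> \<open>The selected boxes are disjoint, so their indicators sum to at most 1 at every
      point.\<close>
    also have "\<dots> \<le> ?A * (\<integral>\<^sup>+x. ennreal (w x) * (ennreal (g x powr q) * indicator {y. l / 2 < g y} x) \<partial>lebesgue)"
    proof (intro mult_left_mono nn_integral_mono)
      fix x
      have "(\<integral>\<^sup>+c. ennreal (g x powr q) * indicator {y. l / 2 < g y} x * ennreal (w x) * indicator (?Q c) x \<partial>count_space C)
        = ennreal (g x powr q) * indicator {y. l / 2 < g y} x * ennreal (w x) * (\<integral>\<^sup>+c. indicator (?Q c) x \<partial>count_space C)"
        by (simp add: nn_integral_cmult)
      also have "\<dots> \<le> ennreal (g x powr q) * indicator {y. l / 2 < g y} x * ennreal (w x) * 1"
        using C(3) by (intro mult_left_mono nn_integral_count_space_disjoint_le_1) auto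
      finally show "(\<integral>\<^sup>+c. ennreal (g x powr q) * indicator {y. l / 2 < g y} x * ennreal (w x) * indicator (?Q c) x \<partial>count_space C)
        \<le> ennreal (w x) * (ennreal (g x powr q) * indicator {y. l / 2 < g y} x)"
        by (simp add: mult_ac)
    qed simp
    also have "(\<integral>\<^sup>+x. ennreal (w x) * (ennreal (g x powr q) * indicator {y. l / 2 < g y} x) \<partial>lebesgue) = ?I"
      by (subst nn_integral_density) auto
    finally show ?thesis .
  qed
  \<comment> \<open>The bound does not depend on i, so the restriction on the radii is removed by
    continuity from below.\<close>
  have "emeasure ?\<mu> (\<Union>i. E i) = (SUP i. emeasure ?\<mu> (E i))"
    using E_sets \<open>incseq E\<close> by (intro SUP_emeasure_incseq[symmetric]) auto
  then show ?thesis
    unfolding E_UN using bound by (simp add: SUP_mult_left_ennreal SUP_le_iff)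
qed

lemma centered_maximal_strong_type:
  fixes R :: "(real^'n) set" and w g :: "real^'n \<Rightarrow> real" and q s D :: real
  assumes R: "rectangle_centered_at 0 R" and q: "1 < q" "q < s" and w: "weight w"
    and g: "g \<in> borel_measurable lebesgue" "\<And>x. 0 \<le> g x" and D: "0 \<le> D"
    and Aq: "\<And>Q. Q \<in> translates_dilates R \<Longrightarrow>
      average Q (\<lambda>y. ennreal (w y)) * epow (average Q (\<lambda>y. epow (ennreal (w y)) (- (1 / (q - 1))))) (q - 1) \<le> ennreal D"
  shows "(\<integral>\<^sup>+x. epow (centered_maximal R (\<lambda>y. ennreal (g y)) x) s \<partial>density lebesgue (\<lambda>x. ennreal (w x)))
    \<le> ennreal (2 powr s * (2 powr (s - q) / (1 - 2 powr (- (s - q))))) *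
       ennreal (2 powr q * ((5 * real CARD('n)) ^ CARD('n)) powr q * D) *
       (\<integral>\<^sup>+x. ennreal (g x powr s) \<partial>density lebesgue (\<lambda>x. ennreal (w x)))"
proof (rule nn_integral_restricted_weak_type)
  have [measurable]: "g \<in> borel_measurable lebesgue" by (fact g)
  show "centered_maximal R (\<lambda>y. ennreal (g y)) \<in> borel_measurable (density lebesgue (\<lambda>x. ennreal (w x)))"
    using measurable_centered_maximal[OF R, of "\<lambda>y. ennreal (g y)"] by simp
  show "g \<in> borel_measurable (density lebesgue (\<lambda>x. ennreal (w x)))" by simp
  fix l :: real assume "0 < l"
  from centered_maximal_weak_type[OF R q(1) w g D Aq this]
  show "ennreal (l powr q) * emeasure (density lebesgue (\<lambda>x. ennreal (w x)))
      {x \<in> space (density lebesgue (\<lambda>x. ennreal (w x))). ennreal l < centered_maximal R (\<lambda>y. ennreal (g y)) x}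
    \<le> ennreal (2 powr q * ((5 * real CARD('n)) ^ CARD('n)) powr q * D) *
       (\<integral>\<^sup>+x. ennreal (g x powr q) * indicator {x. l / 2 < g x} x \<partial>density lebesgue (\<lambda>x. ennreal (w x)))"
    by simp
qed (use q g in auto)

subsection \<open>The starlike maximal operator\<close>

text \<open>Hoelder with exponents s and s': the kernel factor is bounded by hypothesis, and central
  symmetry of R turns the reflected domain of f into a box centered at x. The volume powers combine
  to t^n |R|, and t^(-n) leaves |R|.\<close>

lemma dilate_average_le_centered_maximal:
  fixes R :: "(real^'n) set" and h :: "real^'n \<Rightarrow> real" and f :: "real^'n \<Rightarrow> complex" and s s' C\<^sub>0 t :: real
  assumes R: "rectangle_centered_at 0 R" and s: "1 < s" "1 < s'" "1 / s + 1 / s' = 1" and t: "0 < t"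
    and h: "(\<lambda>y. ennreal (h y)) \<in> borel_measurable lebesgue" "\<And>y. 0 \<le> h y"
    and f: "f \<in> borel_measurable lebesgue" and C\<^sub>0: "0 \<le> C\<^sub>0"
    and bound: "(\<integral>\<^sup>+y\<in>dilate t R. ennreal (h y powr s) \<partial>lebesgue) \<le> ennreal C\<^sub>0 * emeasure lebesgue (dilate t R)"
  shows "ennreal (1 / t ^ CARD('n)) * (\<integral>\<^sup>+y\<in>dilate t R. ennreal (h y * cmod (f (x - y))) \<partial>lebesgue)
    \<le> ennreal (measure lebesgue R * C\<^sub>0 powr (1 / s)) *
        epow (centered_maximal R (\<lambda>y. ennreal (cmod (f y) powr s')) x) (1 / s')"
proof -
  note m = rectangle_measure[OF R]
  define v where "v = t ^ CARD('n) * measure lebesgue R"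
  have v: "0 < v" using t m by (simp add: v_def)
  let ?D = "dilate t R"
  have [measurable]: "?D \<in> sets lebesgue" "shifted_dilate R x t \<in> sets lebesgue"
    using t m(1) by (auto intro: sets_dilate sets_shifted_dilate)
  have [measurable]: "f \<in> borel_measurable lebesgue" by (fact f)
  have [measurable]: "(\<lambda>y. ennreal (h y)) \<in> borel_measurable lebesgue" by (fact h)
  have [measurable]: "(\<lambda>y. f (x - y)) \<in> borel_measurable lebesgue"
    using f by (rule measurable_compose[OF lebesgue_measurable_const_diff])
  let ?I = "\<integral>\<^sup>+y\<in>shifted_dilate R x t. ennreal (cmod (f y) powr s') \<partial>lebesgue"
  have I: "(\<integral>\<^sup>+y\<in>?D. ennreal (cmod (f (x - y)) powr s') \<partial>lebesgue) = ?I"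
  proof -
    have "x - y \<in> shifted_dilate R x t \<longleftrightarrow> y \<in> ?D" for y
      using rectangle_symmetric[OF R, of "(1 / t) *\<^sub>R y"] rectangle_symmetric[OF R, of "- ((1 / t) *\<^sub>R y)"] t
      by (auto simp: mem_shifted_dilate_iff mem_dilate_iff)
    then have "(\<integral>\<^sup>+y\<in>?D. ennreal (cmod (f (x - y)) powr s') \<partial>lebesgue)
        = (\<integral>\<^sup>+y. ennreal (cmod (f (x - y)) powr s') * indicator (shifted_dilate R x t) (x - y) \<partial>lebesgue)"
      by (intro nn_integral_cong) (simp add: indicator_def)
    also have "\<dots> = ?I"
      by (rule nn_integral_lebesgue_reflect[where f="\<lambda>z. ennreal (cmod (f z) powr s') * indicator (shifted_dilate R x t) z"]) measurable
    finally show ?thesis .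
  qed
  have avg: "?I = ennreal v * average (shifted_dilate R x t) (\<lambda>y. ennreal (cmod (f y) powr s'))"
  proof -
    have "ennreal v * (ennreal (1 / v) * ?I) = ?I"
      using v by (simp flip: mult.assoc ennreal_mult')
    then show ?thesis
      unfolding average_shifted_dilate[OF t m(3,2)] v_def by simp
  qed
  have "(\<integral>\<^sup>+y\<in>?D. ennreal (h y * cmod (f (x - y))) \<partial>lebesgue)
      = (\<integral>\<^sup>+y. (ennreal (h y) * indicator ?D y) * (ennreal (cmod (f (x - y))) * indicator ?D y) \<partial>lebesgue)"
    by (intro nn_integral_cong) (auto simp: indicator_def ennreal_mult'')
  also have "\<dots> \<le> epow (\<integral>\<^sup>+y. epow (ennreal (h y) * indicator ?D y) s \<partial>lebesgue) (1 / s) *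
      epow (\<integral>\<^sup>+y. epow (ennreal (cmod (f (x - y))) * indicator ?D y) s' \<partial>lebesgue) (1 / s')"
    using s by (intro nn_integral_Holder) auto
  also have "(\<integral>\<^sup>+y. epow (ennreal (h y) * indicator ?D y) s \<partial>lebesgue) = (\<integral>\<^sup>+y\<in>?D. ennreal (h y powr s) \<partial>lebesgue)"
    using s h by (intro nn_integral_cong) (auto simp: indicator_def epow_ennreal)
  also have "(\<integral>\<^sup>+y. epow (ennreal (cmod (f (x - y))) * indicator ?D y) s' \<partial>lebesgue) = ?I"
    unfolding I[symmetric] using s by (intro nn_integral_cong) (auto simp: indicator_def epow_ennreal)
  also have "epow (\<integral>\<^sup>+y\<in>?D. ennreal (h y powr s) \<partial>lebesgue) (1 / s) \<le> epow (ennreal (C\<^sub>0 * v)) (1 / s)"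
  proof (rule epow_mono)
    show "(\<integral>\<^sup>+y\<in>?D. ennreal (h y powr s) \<partial>lebesgue) \<le> ennreal (C\<^sub>0 * v)"
      using bound C\<^sub>0 t unfolding emeasure_dilate[OF t] m(3) by (simp add: v_def ennreal_mult')
  qed (use s in simp)
  also have "epow (ennreal (C\<^sub>0 * v)) (1 / s) * epow ?I (1 / s')
      = ennreal (C\<^sub>0 powr (1 / s) * (v powr (1 / s) * v powr (1 / s'))) *
        epow (average (shifted_dilate R x t) (\<lambda>y. ennreal (cmod (f y) powr s'))) (1 / s')"
    unfolding avg using s C\<^sub>0 v
    by (simp add: epow_mult epow_ennreal epow_ennreal_pos powr_mult ennreal_mult' mult.assoc)
  also have "v powr (1 / s) * v powr (1 / s') = v"
    using v s by (simp flip: powr_add)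
  finally have "ennreal (1 / t ^ CARD('n)) * (\<integral>\<^sup>+y\<in>?D. ennreal (h y * cmod (f (x - y))) \<partial>lebesgue)
    \<le> ennreal (1 / t ^ CARD('n)) * (ennreal (C\<^sub>0 powr (1 / s) * v) *
        epow (average (shifted_dilate R x t) (\<lambda>y. ennreal (cmod (f y) powr s'))) (1 / s'))"
    by (simp add: mult_left_mono mult_right_mono)
  also have "\<dots> = ennreal (measure lebesgue R * C\<^sub>0 powr (1 / s)) *
        epow (average (shifted_dilate R x t) (\<lambda>y. ennreal (cmod (f y) powr s'))) (1 / s')"
  proof -
    have "1 / t ^ CARD('n) * (C\<^sub>0 powr (1 / s) * v) = measure lebesgue R * C\<^sub>0 powr (1 / s)"
      using t by (simp add: v_def)
    moreover have "ennreal (1 / t ^ CARD('n)) * (ennreal b * z) = ennreal (1 / t ^ CARD('n) * b) * z" for b z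
      using t by (subst ennreal_mult') (simp_all add: mult.assoc)
    ultimately show ?thesis by simp
  qed
  also have "\<dots> \<le> ennreal (measure lebesgue R * C\<^sub>0 powr (1 / s)) *
        epow (centered_maximal R (\<lambda>y. ennreal (cmod (f y) powr s')) x) (1 / s')"
    unfolding centered_maximal_def using s t by (intro mult_left_mono epow_mono SUP_upper) auto
  finally show ?thesis .
qed

text \<open>Dilation preserves null sets, so tS is covered by the sets t R_j almost everywhere for
  each t. The bounds \<open>N j\<close> do not depend on t, so the supremum over t can be taken
  after summation.\<close>

lemma starlike_maximal_le_sum:
  fixes S :: "(real^'n) set" and H :: "real^'n \<Rightarrow> real^'n \<Rightarrow> real" and f :: "real^'n \<Rightarrow> complex"
    and R :: "nat \<Rightarrow> (real^'n) set" and N :: "nat \<Rightarrow> ennreal"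
  assumes cover: "S - (\<Union>j\<in>J. R j) \<in> null_sets lebesgue" and R: "\<And>j. j \<in> J \<Longrightarrow> R j \<in> sets lebesgue"
    and meas: "(\<lambda>y. ennreal (H x y)) \<in> borel_measurable lebesgue" and f: "f \<in> borel_measurable lebesgue"
    and N: "\<And>t j. 0 < t \<Longrightarrow> j \<in> J \<Longrightarrow>
      ennreal (1 / t ^ CARD('n)) * (\<integral>\<^sup>+y\<in>dilate t (R j). ennreal (H x y * cmod (f (x - y))) \<partial>lebesgue) \<le> N j"
  shows "starlike_maximal S H f x \<le> (\<integral>\<^sup>+j. N j \<partial>count_space J)"
  unfolding starlike_maximal_def
proof (rule SUP_least)
  fix t :: real assume "t \<in> {0<..}"
  then have t: "0 < t" by simp
  define G where "G y = ennreal (H x y * cmod (f (x - y)))" for y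
  have "(\<lambda>y. f (x - y)) \<in> borel_measurable lebesgue"
    using f by (rule measurable_compose[OF lebesgue_measurable_const_diff])
  then have "(\<lambda>y. ennreal (H x y) * ennreal (cmod (f (x - y)))) \<in> borel_measurable lebesgue"
    using meas by measurable
  then have [measurable]: "G \<in> borel_measurable lebesgue"
    by (simp add: G_def[abs_def] ennreal_mult'')
  have [measurable]: "dilate t (R j) \<in> sets lebesgue" if "j \<in> J" for j
    using sets_dilate[OF t R[OF that]] .
  have null: "dilate t (S - (\<Union>j\<in>J. R j)) \<in> null_sets lebesgue"
    using cover t by (intro null_setsI sets_dilate) (auto simp: emeasure_dilate[OF t] simp del: emeasure_completion)
  have "(\<integral>\<^sup>+y\<in>dilate t S. G y \<partial>lebesgue) \<le> (\<integral>\<^sup>+y. (\<integral>\<^sup>+j. G y * indicator (dilate t (R j)) y \<partial>count_space J) \<partial>lebesgue)"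
  proof (rule nn_integral_mono_AE)
    show "AE y in lebesgue. G y * indicator (dilate t S) y \<le> (\<integral>\<^sup>+j. G y * indicator (dilate t (R j)) y \<partial>count_space J)"
      using AE_not_in[OF null]
    proof eventually_elim
      case (elim y)
      show ?case
      proof (cases "y \<in> dilate t S")
        case True
        then obtain j where j: "j \<in> J" "y \<in> dilate t (R j)"
          using elim t by (auto simp: mem_dilate_iff)
        then show ?thesis
          using nn_integral_ge_point[of j J "\<lambda>j. G y * indicator (dilate t (R j)) y"] True by simp
      qed simp
    qed
  qed
  also have "\<dots> = (\<integral>\<^sup>+j. (\<integral>\<^sup>+y. G y * indicator (dilate t (R j)) y \<partial>lebesgue) \<partial>count_space J)"
    by (intro nn_integral_count_space_nn_integral) auto
  finally have "ennreal (1 / t ^ CARD('n)) * (\<integral>\<^sup>+y\<in>dilate t S. G y \<partial>lebesgue)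
     \<le> ennreal (1 / t ^ CARD('n)) * (\<integral>\<^sup>+j. (\<integral>\<^sup>+y. G y * indicator (dilate t (R j)) y \<partial>lebesgue) \<partial>count_space J)"
    by (rule mult_left_mono) simp
  also have "\<dots> = (\<integral>\<^sup>+j. ennreal (1 / t ^ CARD('n)) * (\<integral>\<^sup>+y. G y * indicator (dilate t (R j)) y \<partial>lebesgue) \<partial>count_space J)"
    by (simp add: nn_integral_cmult)
  also have "\<dots> \<le> (\<integral>\<^sup>+j. N j \<partial>count_space J)"
    using N[OF t] by (intro nn_integral_mono) (auto simp: G_def)
  finally show "ennreal (1 / t ^ CARD('n)) * (\<integral>\<^sup>+y\<in>dilate t S. ennreal (H x y * cmod (f (x - y))) \<partial>lebesgue)
     \<le> (\<integral>\<^sup>+j. N j \<partial>count_space J)"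
    by (simp add: G_def)
qed

lemma nn_integral_count_space_eq_infsum:
  fixes K :: "'i \<Rightarrow> real"
  assumes "\<And>j. j \<in> J \<Longrightarrow> 0 \<le> K j" "K summable_on J"
  shows "(\<integral>\<^sup>+j. ennreal (K j) \<partial>count_space J) = ennreal (\<Sum>\<^sub>\<infinity>j\<in>J. K j)"
proof -
  have "(\<lambda>j. norm (K j)) summable_on J"
    using assms by (subst summable_on_cong[where g=K]) auto
  then have "Infinite_Set_Sum.abs_summable_on K J"
    using abs_summable_equivalent by blast
  then show ?thesis
    using assms by (simp add: nn_integral_conv_infsetsum infsetsum_infsum)
qed

theorem theorem2p4:
  fixes p p' r r' \<sigma> C\<^sub>0 c :: real
  assumes "1 < p" and "1 / p + 1 / p' = 1"
    and "1 < r" and "1 / r + 1 / r' = 1"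
    and "\<sigma> > r' * p'"
    and "0 \<le> C\<^sub>0"
  shows "\<exists>C\<ge>0. \<forall>(H :: real^'n \<Rightarrow> real^'n \<Rightarrow> real) (S :: (real^'n) set) (J :: nat set)
            (R :: nat \<Rightarrow> (real^'n) set) (w :: real^'n \<Rightarrow> real) (K :: nat \<Rightarrow> real).
          (\<lambda>(x, y). H x y) \<in> borel_measurable lebesgue \<longrightarrow>
          (\<forall>x y. 0 \<le> H x y) \<longrightarrow>
          S \<in> sets lebesgue \<longrightarrow>
          star_shaped S \<longrightarrow>
          starlike_cover c S J R \<longrightarrow>
          weight w \<longrightarrow>
          (\<forall>j\<in>J. 0 \<le> K j) \<longrightarrow>
          K summable_on J \<longrightarrow>
          (\<forall>j\<in>J. \<forall>Q\<in>translates_dilates (R j).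
             epow (average Q (\<lambda>y. ennreal (w y))) (1 / p) *
             epow (average Q (\<lambda>y. epow (ennreal (w y)) (- (r * p' / p)))) (1 / (r * p'))
               \<le> ennreal (K j / measure lebesgue (R j))) \<longrightarrow>
          (\<forall>j\<in>J. \<forall>t>0. \<forall>x.
             (\<integral>\<^sup>+y\<in>dilate t (R j). ennreal (H x y powr \<sigma>) \<partial>lebesgue)
               \<le> ennreal C\<^sub>0 * emeasure lebesgue (dilate t (R j))) \<longrightarrow>
          bounded_on_Lpw p w (starlike_maximal S H) (C * (\<Sum>\<^sub>\<infinity>j\<in>J. K j))"
proof -
  note p = assms(1) and r = assms(3) and C\<^sub>0 = assms(6)
  \<comment> \<open>This q satisfies 1/(q-1) = r p'/p and q - 1 = p/(r p'), so the p-th power of the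
    weight hypothesis is an A_q condition; \<open>s'\<close> is the conjugate exponent of
    \<sigma>.\<close>
  define q s' where "q = 1 + (p - 1) / r" and "s' = \<sigma> / (\<sigma> - 1)"
  have p': "p' = p / (p - 1)"
  proof -
    have "1 / p' = (p - 1) / p" using assms(1,2) by (simp add: field_simps)
    then show ?thesis by (metis div_by_1 divide_divide_eq_right mult_1)
  qed
  have r': "r' = r / (r - 1)"
  proof -
    have "1 / r' = (r - 1) / r" using assms(3,4) by (simp add: field_simps)
    then show ?thesis by (metis div_by_1 divide_divide_eq_right mult_1)
  qed
  have exps: "r * p' / p = 1 / (q - 1)" "1 / (r * p') * p = q - 1" "0 < r * p'"
    using p r by (auto simp: q_def p')
  have q: "1 < q" using p r by (simp add: q_def)
  have big: "r * p / ((r - 1) * (p - 1)) < \<sigma>"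
    using assms(5) by (simp add: p' r')
  have \<sigma>: "1 < \<sigma>"
  proof -
    have "(r - 1) * (p - 1) < r * p" using p r by (simp add: algebra_simps)
    then have "1 < r * p / ((r - 1) * (p - 1))" using p r by simp
    then show ?thesis using big by simp
  qed
  then have s': "1 < s'" "1 / \<sigma> + 1 / s' = 1" by (auto simp: s'_def field_simps)
  \<comment> \<open>After clearing denominators this is \<sigma> (r-1)(p-1) > r p, which is the
    assumption on \<sigma>.\<close>
  have qs: "q < p / s'"
  proof -
    have "p * r < \<sigma> * ((r - 1) * (p - 1))"
      using big p r by (simp add: pos_divide_less_eq mult.commute)
    then have "(r + (p - 1)) * \<sigma> < r * p * (\<sigma> - 1)"
      by (simp add: algebra_simps)
    then have "(r + (p - 1)) / r < p * (\<sigma> - 1) / \<sigma>"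
      using r \<sigma> by (simp add: divide_simps mult_ac)
    then show ?thesis using r by (simp add: q_def s'_def add_divide_distrib)
  qed
  \<comment> \<open>The constant of the strong-type bound on L^(p/s') without its factor D. It
    depends only on n, p, r and \<sigma>, so C can be fixed before the kernel, the sets and the
    weight.\<close>
  define A where "A = 2 powr (p / s') * (2 powr (p / s' - q) / (1 - 2 powr (- (p / s' - q)))) *
      (2 powr q * ((5 * real CARD('n)) ^ CARD('n)) powr q)"
  have "2 powr (- (p / s' - q)) < 1"
    using qs by (intro powr_less_one) auto
  then have A: "0 \<le> A"
    by (auto simp: A_def intro!: mult_nonneg_nonneg divide_nonneg_nonneg)
  define C where "C = C\<^sub>0 powr (1 / \<sigma>) * A powr (1 / p)"
  have C: "0 \<le> C" by (simp add: C_def)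
  show ?thesis
  proof (intro exI[of _ C] conjI C allI impI)
    fix H :: "real^'n \<Rightarrow> real^'n \<Rightarrow> real" and S :: "(real^'n) set" and J :: "nat set"
      and R :: "nat \<Rightarrow> (real^'n) set" and w :: "real^'n \<Rightarrow> real" and K :: "nat \<Rightarrow> real"
    assume H: "(\<lambda>(x, y). H x y) \<in> borel_measurable lebesgue" "\<forall>x y. 0 \<le> H x y"
      and S: "S \<in> sets lebesgue" "star_shaped S" and cover: "starlike_cover c S J R" and w: "weight w"
      and K: "\<forall>j\<in>J. 0 \<le> K j" "K summable_on J"
      and Aq_hyp: "\<forall>j\<in>J. \<forall>Q\<in>translates_dilates (R j).
             epow (average Q (\<lambda>y. ennreal (w y))) (1 / p) *
             epow (average Q (\<lambda>y. epow (ennreal (w y)) (- (r * p' / p)))) (1 / (r * p'))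
               \<le> ennreal (K j / measure lebesgue (R j))"
      and Hbound: "\<forall>j\<in>J. \<forall>t>0. \<forall>x.
             (\<integral>\<^sup>+y\<in>dilate t (R j). ennreal (H x y powr \<sigma>) \<partial>lebesgue)
               \<le> ennreal C\<^sub>0 * emeasure lebesgue (dilate t (R j))"
    have R: "rectangle_centered_at 0 (R j)" if "j \<in> J" for j
      using cover that by (auto simp: starlike_cover_def)
    have [measurable]: "w \<in> borel_measurable lebesgue"
      using w by (auto simp: weight_def)
    let ?\<mu> = "density lebesgue (\<lambda>x. ennreal (w x))"
    show "bounded_on_Lpw p w (starlike_maximal S H) (C * (\<Sum>\<^sub>\<infinity>j\<in>J. K j))"
      unfolding bounded_on_Lpw_def
    proof (intro allI impI conjI; elim conjE)
      fix f :: "real^'n \<Rightarrow> complex" assume f: "f \<in> borel_measurable lebesgue"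
      note [measurable] = f
      show "starlike_maximal S H f \<in> borel_measurable lebesgue"
        by (rule starlike_maximal_measurable[OF H(1) f S])
      define N where "N j x = ennreal (measure lebesgue (R j) * C\<^sub>0 powr (1 / \<sigma>)) *
        epow (centered_maximal (R j) (\<lambda>y. ennreal (cmod (f y) powr s')) x) (1 / s')" for j x
      have N_meas [measurable]: "N j \<in> borel_measurable ?\<mu>" if "j \<in> J" for j
        unfolding N_def[abs_def] using measurable_centered_maximal[OF R[OF that], of "\<lambda>y. ennreal (cmod (f y) powr s')"]
        by simp
      define F where "F = (\<integral>\<^sup>+x. epow (ennreal (cmod (f x))) p \<partial>?\<mu>)"
      have N_bound: "(\<integral>\<^sup>+x. epow (N j x) p \<partial>?\<mu>) \<le> ennreal ((C * K j) powr p) * F" if j: "j \<in> J" for j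
      proof -
        define m where "m = measure lebesgue (R j)"
        have m: "0 < m" using rectangle_measure[OF R[OF j]] by (simp add: m_def)
        \<comment> \<open>The A_q constant is the p-th power of the constant in the weight
          hypothesis. Its denominator m^p later cancels the factor m^p from the pointwise bound
          \<open>N j\<close>.\<close>
        define D where "D = (K j / m) powr p"
        have Kj: "0 \<le> K j" using K j by blast
        have Aq: "average Q (\<lambda>y. ennreal (w y)) *
            epow (average Q (\<lambda>y. epow (ennreal (w y)) (- (1 / (q - 1))))) (q - 1) \<le> ennreal D"
          if "Q \<in> translates_dilates (R j)" for Q
        proof -
          have "epow (average Q (\<lambda>y. ennreal (w y))) (1 / p) *
             epow (average Q (\<lambda>y. epow (ennreal (w y)) (- (1 / (q - 1))))) (1 / (r * p')) \<le> ennreal (K j / m)"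
            using Aq_hyp j that unfolding m_def exps(1) by blast
          from epow_mono[OF _ this, of p] show ?thesis
            using p m Kj exps(2,3) by (simp add: epow_mult epow_epow epow_ennreal D_def)
        qed
        let ?M = "centered_maximal (R j) (\<lambda>y. ennreal (cmod (f y) powr s'))"
        have "(\<integral>\<^sup>+x. epow (?M x) (p / s') \<partial>?\<mu>) \<le> ennreal (2 powr (p / s') * (2 powr (p / s' - q) / (1 - 2 powr (- (p / s' - q))))) *
           ennreal (2 powr q * ((5 * real CARD('n)) ^ CARD('n)) powr q * D) *
           (\<integral>\<^sup>+x. ennreal ((cmod (f x) powr s') powr (p / s')) \<partial>?\<mu>)"
          using Aq by (intro centered_maximal_strong_type R j q qs w) (auto simp: D_def)
        also have "(\<integral>\<^sup>+x. ennreal ((cmod (f x) powr s') powr (p / s')) \<partial>?\<mu>) = F"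
          unfolding F_def using s' p by (intro nn_integral_cong) (auto simp: powr_powr epow_ennreal)
        also have "ennreal (2 powr (p / s') * (2 powr (p / s' - q) / (1 - 2 powr (- (p / s' - q))))) *
           ennreal (2 powr q * ((5 * real CARD('n)) ^ CARD('n)) powr q * D) = ennreal (A * D)"
          by (simp add: A_def D_def mult.assoc flip: ennreal_mult'')
        finally have M: "(\<integral>\<^sup>+x. epow (?M x) (p / s') \<partial>?\<mu>) \<le> ennreal (A * D) * F" .
        have "(\<integral>\<^sup>+x. epow (N j x) p \<partial>?\<mu>) = (\<integral>\<^sup>+x. ennreal ((m * C\<^sub>0 powr (1 / \<sigma>)) powr p) * epow (?M x) (p / s') \<partial>?\<mu>)"
          using p s' m by (intro nn_integral_cong) (simp add: N_def m_def epow_mult epow_epow epow_ennreal)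
        also have "\<dots> = ennreal ((m * C\<^sub>0 powr (1 / \<sigma>)) powr p) * (\<integral>\<^sup>+x. epow (?M x) (p / s') \<partial>?\<mu>)"
          using measurable_centered_maximal[OF R[OF j], of "\<lambda>y. ennreal (cmod (f y) powr s')"]
          by (intro nn_integral_cmult) simp
        also have "\<dots> \<le> ennreal ((m * C\<^sub>0 powr (1 / \<sigma>)) powr p) * (ennreal (A * D) * F)"
          by (intro mult_left_mono M) simp
        also have "\<dots> = ennreal ((m * C\<^sub>0 powr (1 / \<sigma>)) powr p * (A * D)) * F"
          by (simp add: ennreal_mult' mult.assoc)
        also have "(m * C\<^sub>0 powr (1 / \<sigma>)) powr p * (A * D) = (C * K j) powr p"
          using m Kj A p by (simp add: D_def C_def powr_mult powr_divide powr_powr)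
        finally show ?thesis .
      qed
      \<comment> \<open>The pointwise bound is available only for those x whose section of H is
        Lebesgue measurable, which is almost every x.\<close>
      have ae: "AE x in lebesgue. starlike_maximal S H f x \<le> (\<integral>\<^sup>+j. N j x \<partial>count_space J)"
      proof -
        have "(\<lambda>z. ennreal (case z of (x, y) \<Rightarrow> H x y)) \<in> borel_measurable lebesgue"
          using H(1) by measurable
        from AE_lebesgue_measurable_section[OF this]
        show ?thesis
        proof eventually_elim
          case (elim x)
          then have Hx: "(\<lambda>y. ennreal (H x y)) \<in> borel_measurable lebesgue" by simp
          show ?case
          proof (rule starlike_maximal_le_sum[where R=R])
            show "S - (\<Union>j\<in>J. R j) \<in> null_sets lebesgue"
              using cover by (simp add: starlike_cover_def)
            show "R j \<in> sets lebesgue" if "j \<in> J" for j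
              using rectangle_measure[OF R[OF that]] by blast
            show "ennreal (1 / t ^ CARD('n)) * (\<integral>\<^sup>+y\<in>dilate t (R j). ennreal (H x y * cmod (f (x - y))) \<partial>lebesgue) \<le> N j x"
              if "0 < t" "j \<in> J" for t j
              unfolding N_def
              using H(2) Hbound that by (intro dilate_average_le_centered_maximal R \<sigma> s' Hx f C\<^sub>0) auto
          qed (fact Hx f)+
        qed
      qed
      \<comment> \<open>The weighted measure has a density, so it inherits the null sets of Lebesgue
        measure.\<close>
      then have ae': "AE x in ?\<mu>. starlike_maximal S H f x \<le> (\<integral>\<^sup>+j. N j x \<partial>count_space J)"
        by (subst AE_density) (auto elim: eventually_mono)
      let ?B = "C * (\<Sum>\<^sub>\<infinity>j\<in>J. K j)"
      have B: "0 \<le> ?B" using C K by (auto intro!: mult_nonneg_nonneg infsum_nonneg)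
      have "(\<integral>\<^sup>+x. epow (starlike_maximal S H f x) p \<partial>?\<mu>)
        \<le> (\<integral>\<^sup>+x. epow (\<integral>\<^sup>+j. N j x \<partial>count_space J) p \<partial>?\<mu>)"
        using ae' p by (intro nn_integral_mono_AE) (auto elim!: eventually_mono intro: epow_mono)
      \<comment> \<open>The triangle inequality for countable sums, with the individual norm bounds
        \<open>C * K j\<close> as weights.\<close>
      also have "\<dots> \<le> epow (\<integral>\<^sup>+j. ennreal (C * K j) \<partial>count_space J) p * F"
        using p C K(1) N_bound by (intro nn_integral_epow_sum_le N_meas) auto
      also have "(\<integral>\<^sup>+j. ennreal (C * K j) \<partial>count_space J) = ennreal ?B"
        using C K by (simp add: ennreal_mult' nn_integral_cmult nn_integral_count_space_eq_infsum)
      finally have "(\<integral>\<^sup>+x. epow (starlike_maximal S H f x) p \<partial>?\<mu>) \<le> epow (ennreal ?B) p * F" .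
      then have "epow (\<integral>\<^sup>+x. epow (starlike_maximal S H f x) p \<partial>?\<mu>) (1 / p) \<le> epow (epow (ennreal ?B) p * F) (1 / p)"
        using p by (intro epow_mono) auto
      also have "\<dots> = ennreal ?B * epow F (1 / p)"
        using p by (simp add: epow_mult epow_epow)
      finally show "Lpw_norm p w (starlike_maximal S H f) \<le> ennreal ?B * Lpw_norm p w (\<lambda>x. ennreal (cmod (f x)))"
        by (simp add: Lpw_norm_def F_def)
    qed
  qed
qed

end
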